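(* Let $N\ge3$, $\max\{0,\frac{N-4}{2}\}\le a<\frac{N-2}{2}$, $a<b<a+1$, $p,q>1$ with $2<p+q<2^\sharp$, $\rho_1,\rho_2>0$, and $\beta\le0$. Then $m_\beta(\rho_1,\rho_2)$ is not achieved, i.e. there is no $(u,v)\in\mathcal N_\beta(\rho_1,\rho_2)$ with $E_\beta(u,v)=m_\beta(\rho_1,\rho_2)$.
   Context: Notation: $d:=1+a-b\in(0,1)$, $2^\sharp:=\frac{2N}{N-2d}$, $\delta_s:=\frac{(N-2a+2b)s-2N}{2s}$. $\|\cdot\|_s$ is the norm of $L^s(\mathbb{R}^N)$. $\mathcal D^{1,2}_a(\mathbb R^N)$ is the completion of $C_0^\infty(\mathbb{R}^N)$ in the norm $\||x|^{-a}\nabla u\|_2$, $\mathcal D^{1,2}_{a,r}$ its radial subspace, $X:=\mathcal D^{1,2}_{a,r}(\mathbb{R}^N)\cap L^2_r(\mathbb{R}^N;|x|^{-2a})$ (real-valued radial functions), $\mathcal X:=X\times X$. $\mathcal B_{p,q}(u,v):=\int_{\mathbb{R}^N}\frac{|u|^p|v|^q}{|x|^{b(p+q)}}dx$. Energy: $E_\beta(u,v)=\frac12(\||x|^{-a}\nabla u\|_2^2+\||x|^{-a}\nabla v\|_2^2)-\beta\mathcal B_{p,q}(u,v)-\frac1{2^\sharp}(\||x|^{-b}u\|_{2^\sharp}^{2^\sharp}+\||x|^{-b}v\|_{2^\sharp}^{2^\sharp})$ on $\mathcal X$. Pohozaev functional: $P_\beta(u,v)=\||x|^{-a}\nabla u\|_2^2+\||x|^{-a}\nabla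 v\|_2^2-\beta(p+q)\delta_{p+q}\mathcal B_{p,q}(u,v)-(\||x|^{-b}u\|_{2^\sharp}^{2^\sharp}+\||x|^{-b}v\|_{2^\sharp}^{2^\sharp})$. $S(\rho_1,\rho_2):=\{(u,v)\in\mathcal X:\||x|^{-a}u\|_2^2=\rho_1^2,\ \||x|^{-a}v\|_2^2=\rho_2^2\}$, $\mathcal N_\beta(\rho_1,\rho_2):=\{(u,v)\in S(\rho_1,\rho_2):P_\beta(u,v)=0\}$, $m_\beta(\rho_1,\rho_2):=\inf_{\mathcal N_\beta(\rho_1,\rho_2)}E_\beta$. *)

theory Defs
  imports "HOL-Analysis.Analysis"
begin

section \<open>Test functions\<close>

definition partial_deriv :: "'n::finite \<Rightarrow> (real^'n \<Rightarrow> real) \<Rightarrow> real^'n \<Rightarrow> real" where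
  "partial_deriv i f x = frechet_derivative f (at x) (axis i 1)"

definition gradient :: "(real^'n::finite \<Rightarrow> real) \<Rightarrow> real^'n \<Rightarrow> real^'n" where
  "gradient f x = (\<chi> i. partial_deriv i f x)"

primrec C_diff :: "nat \<Rightarrow> (real^'n::finite \<Rightarrow> real) \<Rightarrow> bool" where
  "C_diff 0 f \<longleftrightarrow> continuous_on UNIV f"
| "C_diff (Suc k) f \<longleftrightarrow>
     (\<forall>x. f differentiable (at x)) \<and> (\<forall>i. C_diff k (partial_deriv i f))"

definition test_functions :: "(real^'n::finite \<Rightarrow> real) set" where
  "test_functions = {f. (\<forall>k. C_diff k f) \<and> compact (closure {x. f x \<noteq> 0})}"


section \<open>The function spaces\<close>

definition L_norm :: "real \<Rightarrow> (real^'n::finite \<Rightarrow> real) \<Rightarrow> real" where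
  "L_norm s f = (\<integral>x. \<bar>f x\<bar> powr s \<partial>lborel) powr (1 / s)"

text \<open>
  The completion of the test functions in the norm of \<open>|x|\<^sup>-\<^sup>a \<nabla>\<phi>\<close> in \<open>L\<^sup>2\<close> is realised as a
  space of functions: \<open>u\<close> belongs to it, with gradient \<open>G\<close>, iff some sequence of test functions
  \<open>\<phi> n\<close> converges to \<open>u\<close> in \<open>L\<^sup>1\<close> on compact sets while \<open>\<nabla>(\<phi> n)\<close> converges to \<open>G\<close> in the
  weighted norm.  For \<open>0 \<le> a < (N - 2) / 2\<close> the weighted Hardy inequality makes every Cauchy
  sequence of test functions converge in this sense, and \<open>u\<close> determines \<open>G\<close> almost everywhere
  (\<open>G\<close> is the distributional gradient of \<open>u\<close>), so this is the abstract completion.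
\<close>

definition D_limit ::
    "real \<Rightarrow> (real^'n::finite \<Rightarrow> real) \<Rightarrow> (real^'n \<Rightarrow> real^'n) \<Rightarrow> bool" where
  "D_limit a u G \<longleftrightarrow>
     u \<in> borel_measurable borel \<and> G \<in> borel_measurable borel \<and>
     (\<exists>\<phi> :: nat \<Rightarrow> real^'n \<Rightarrow> real.
        (\<forall>n. \<phi> n \<in> test_functions) \<and>
        (\<forall>K. compact K \<longrightarrow>
           (\<lambda>n. \<integral>\<^sup>+x\<in>K. ennreal \<bar>\<phi> n x - u x\<bar> \<partial>lborel) \<longlonglongrightarrow> 0) \<and>
        (\<lambda>n. \<integral>\<^sup>+x. ennreal ((norm x powr (- a) * norm (gradient (\<phi> n) x - G x))\<^sup>2) \<partial>lborel)
           \<longlonglongrightarrow> 0)"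

definition D_space :: "real \<Rightarrow> (real^'n::finite \<Rightarrow> real) set" where
  "D_space a = {u. \<exists>G. D_limit a u G}"

definition D_grad :: "real \<Rightarrow> (real^'n::finite \<Rightarrow> real) \<Rightarrow> real^'n \<Rightarrow> real^'n" where
  "D_grad a u = (SOME G. D_limit a u G)"

text \<open>
  Elements of the spaces are Borel representatives of classes modulo null sets, so radial
  symmetry is required almost everywhere.
\<close>

definition radial :: "(real^'n::finite \<Rightarrow> real) \<Rightarrow> bool" where
  "radial u \<longleftrightarrow> (\<exists>f :: real \<Rightarrow> real. AE x in lborel. u x = f (norm x))"

definition X_space :: "real \<Rightarrow> (real^'n::finite \<Rightarrow> real) set" where
  "X_space a =
     {u \<in> D_space a. radial u \<and> integrable lborel (\<lambda>x. norm x powr (- 2 * a) * (u x)\<^sup>2)}"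


section \<open>Energy, Pohozaev functional and constraint sets\<close>

definition two_sharp :: "'n itself \<Rightarrow> real \<Rightarrow> real \<Rightarrow> real" where
  "two_sharp _ a b = 2 * real CARD('n) / (real CARD('n) - 2 * (1 + a - b))"

definition delta :: "'n itself \<Rightarrow> real \<Rightarrow> real \<Rightarrow> real \<Rightarrow> real" where
  "delta _ a b s =
     ((real CARD('n) - 2 * a + 2 * b) * s - 2 * real CARD('n)) / (2 * s)"

definition B_int ::
    "real \<Rightarrow> real \<Rightarrow> real \<Rightarrow> (real^'n::finite \<Rightarrow> real) \<Rightarrow> (real^'n \<Rightarrow> real) \<Rightarrow> real" where
  "B_int b p q u v =
     (\<integral>x. \<bar>u x\<bar> powr p * \<bar>v x\<bar> powr q / norm x powr (b * (p + q)) \<partial>lborel)"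

definition grad_norm :: "real \<Rightarrow> (real^'n::finite \<Rightarrow> real) \<Rightarrow> real" where
  "grad_norm a u = L_norm 2 (\<lambda>x. norm x powr (- a) * norm (D_grad a u x))"

definition weighted_norm :: "real \<Rightarrow> real \<Rightarrow> (real^'n::finite \<Rightarrow> real) \<Rightarrow> real" where
  "weighted_norm c s u = L_norm s (\<lambda>x. norm x powr (- c) * u x)"

definition energy :: "real \<Rightarrow> real \<Rightarrow> real \<Rightarrow> real \<Rightarrow> real \<Rightarrow>
    (real^'n::finite \<Rightarrow> real) \<Rightarrow> (real^'n \<Rightarrow> real) \<Rightarrow> real" where
  "energy a b p q \<beta> u v =
     (let t = two_sharp TYPE('n) a b in
       1 / 2 * ((grad_norm a u)\<^sup>2 + (grad_norm a v)\<^sup>2)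
       - \<beta> * B_int b p q u v
       - 1 / t * (weighted_norm b t u powr t + weighted_norm b t v powr t))"

definition pohozaev :: "real \<Rightarrow> real \<Rightarrow> real \<Rightarrow> real \<Rightarrow> real \<Rightarrow>
    (real^'n::finite \<Rightarrow> real) \<Rightarrow> (real^'n \<Rightarrow> real) \<Rightarrow> real" where
  "pohozaev a b p q \<beta> u v =
     (let t = two_sharp TYPE('n) a b in
       (grad_norm a u)\<^sup>2 + (grad_norm a v)\<^sup>2
       - \<beta> * (p + q) * delta TYPE('n) a b (p + q) * B_int b p q u v
       - (weighted_norm b t u powr t + weighted_norm b t v powr t))"

definition S_set :: "real \<Rightarrow> real \<Rightarrow> real \<Rightarrow>
    ((real^'n::finite \<Rightarrow> real) \<times> (real^'n \<Rightarrow> real)) set" where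
  "S_set a \<rho>1 \<rho>2 =
     {(u, v) \<in> X_space a \<times> X_space a.
        (weighted_norm a 2 u)\<^sup>2 = \<rho>1\<^sup>2 \<and> (weighted_norm a 2 v)\<^sup>2 = \<rho>2\<^sup>2}"

definition N_set :: "real \<Rightarrow> real \<Rightarrow> real \<Rightarrow> real \<Rightarrow> real \<Rightarrow> real \<Rightarrow> real \<Rightarrow>
    ((real^'n::finite \<Rightarrow> real) \<times> (real^'n \<Rightarrow> real)) set" where
  "N_set a b p q \<beta> \<rho>1 \<rho>2 = {(u, v) \<in> S_set a \<rho>1 \<rho>2. pohozaev a b p q \<beta> u v = 0}"

text \<open>The infimum is taken in the extended reals, where it needs no side condition.\<close>

definition m_level :: "'n::finite itself \<Rightarrow> real \<Rightarrow> real \<Rightarrow> real \<Rightarrow> real \<Rightarrow> real \<Rightarrow>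
    real \<Rightarrow> real \<Rightarrow> ereal" where
  "m_level _ a b p q \<beta> \<rho>1 \<rho>2 =
     (INF (u, v) \<in> (N_set a b p q \<beta> \<rho>1 \<rho>2 :: ((real^'n \<Rightarrow> real) \<times> (real^'n \<Rightarrow> real)) set).
        ereal (energy a b p q \<beta> u v))"

end

theory Submission
  imports Defs
begin

text \<open>
  Why the infimum is not attained.  Let \<open>(u, v)\<close> lie on the constraint set, write \<open>A\<close> and \<open>B\<close> for the
  squared weighted gradient norms of \<open>u\<close> and \<open>v\<close>, \<open>C\<close> and \<open>V\<close> for their critical integrals, \<open>I\<close> for
  the coupling integral, and \<open>t\<close> for the critical exponent.  With \<open>\<sigma> = (p + q) \<delta>(p + q)\<close>,
  which lies in \<open>(0, t)\<close>, the constraint says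
  \<open>A + B - \<beta> \<sigma> I = C + V\<close>.  Eliminating \<open>C + V\<close>, the energy equals
  \<open>(1/2 - 1/t) (A + B) - \<beta> (1 - \<sigma>/t) I\<close>, which is at least \<open>(1/2 - 1/t) (A + B)\<close> since \<open>\<beta> \<le> 0\<close>.
  Also \<open>A + B \<le> C + V\<close>, so \<open>A \<le> C\<close> or \<open>B \<le> V\<close>; by symmetry let \<open>A \<le> C\<close>.

  A cheaper pair is built from \<open>u\<close> alone.  The dilation \<open>u\<^sub>s(x) = s\<^bsup>(N - 2a)/2\<^esup> u(s x)\<close> keeps the mass,
  and multiplies \<open>A\<close> by \<open>s\<^sup>2\<close> and \<open>C\<close> by \<open>s\<^bsup>t\<^esup>\<close>.  The competitor is \<open>(u\<^sub>s, c u\<^bsub>s\<tau>\<^esub>)\<close> with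
  \<open>c = \<rho>2/\<rho>1\<close>.  As \<open>\<tau> \<rightarrow> 0\<close> its second component spreads out and contributes nothing, and the
  interaction with the first one vanishes.  What is left is the one-component problem, where
  \<open>A \<le> C\<close> makes the Pohozaev equation solvable with \<open>s\<close> at most slightly above \<open>1\<close>.  The energy
  of the competitor is then close to at most \<open>(1/2 - 1/t) A\<close>, hence below \<open>(1/2 - 1/t) (A + B)\<close>,
  because \<open>B > 0\<close>.

  Three points carry the analysis.  The gradient of a function is determined almost everywhere
  (\<open>D_limit_unique\<close>), so that gradient norms scale; this follows by integrating the gradient along
  segments (\<open>D_limit_increment\<close>).  A nonzero function of the space has a nonzero gradient
  (\<open>grad_norm_pos\<close>), since otherwise it is constant, and nonzero constants have infinite mass.
  Finally the interaction tends to zero (\<open>B_int_mass_dilate_tendsto_0\<close>): \<open>A \<le> C\<close> and \<open>A > 0\<close> force the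
  critical integral of \<open>u\<close> to be finite, and together with the finite mass this bounds all the
  subcritical integrals.
\<close>

section \<open>Lebesgue integrals under dilations and translations\<close>

lemma nn_integral_dilation:
  fixes f :: "'a::euclidean_space \<Rightarrow> ennreal"
  assumes [measurable]: "f \<in> borel_measurable borel" and "0 < s"
  shows "(\<integral>\<^sup>+x. f (s *\<^sub>R x) \<partial>lborel) = ennreal (s powr (- real DIM('a))) * (\<integral>\<^sup>+x. f x \<partial>lborel)"
proof -
  have "(\<integral>\<^sup>+x. f x \<partial>lborel) = ennreal (s ^ DIM('a)) * (\<integral>\<^sup>+x. f (s *\<^sub>R x) \<partial>lborel)"
    by (subst lborel_affine[of s 0]) (use \<open>0 < s\<close> in
      \<open>simp_all add: nn_integral_density nn_integral_distr nn_integral_cmult\<close>)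
  then have "ennreal (s powr (- real DIM('a))) * (\<integral>\<^sup>+x. f x \<partial>lborel)
      = ennreal (s powr (- real DIM('a)) * s ^ DIM('a)) * (\<integral>\<^sup>+x. f (s *\<^sub>R x) \<partial>lborel)"
    using \<open>0 < s\<close> by (simp add: ennreal_mult mult.assoc)
  also have "s powr (- real DIM('a)) * s ^ DIM('a) = 1"
    using \<open>0 < s\<close> by (simp add: powr_minus powr_realpow)
  finally show ?thesis by simp
qed

lemma integral_dilation:
  fixes f :: "'a::euclidean_space \<Rightarrow> real"
  assumes [measurable]: "f \<in> borel_measurable borel" and "0 < s"
  shows "(\<integral>x. f (s *\<^sub>R x) \<partial>lborel) = s powr (- real DIM('a)) * (\<integral>x. f x \<partial>lborel)"
proof -
  have "(\<integral>x. f x \<partial>lborel) = s ^ DIM('a) * (\<integral>x. f (s *\<^sub>R x) \<partial>lborel)"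
    by (subst lborel_affine[of s 0]) (use \<open>0 < s\<close> in
      \<open>simp_all add: integral_density integral_distr\<close>)
  then show ?thesis
    using \<open>0 < s\<close> by (simp add: powr_minus powr_realpow)
qed

lemma integrable_dilation:
  fixes f :: "'a::euclidean_space \<Rightarrow> real"
  assumes "integrable lborel f" and "0 < s"
  shows "integrable lborel (\<lambda>x. f (s *\<^sub>R x))"
proof -
  have [measurable]: "f \<in> borel_measurable borel" using assms(1) by auto
  have "(\<integral>\<^sup>+x. ennreal (norm (f (s *\<^sub>R x))) \<partial>lborel) < \<infinity>"
    using assms by (subst nn_integral_dilation[of "\<lambda>x. ennreal (norm (f x))"])
      (auto simp: integrable_iff_bounded ennreal_mult_less_top)
  then show ?thesis by (auto simp: integrable_iff_bounded)
qed

text \<open>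
  Dilations map null sets to null sets; radial symmetry, which holds only almost everywhere,
  survives dilation for this reason.
\<close>

lemma AE_dilation:
  fixes P :: "'a::euclidean_space \<Rightarrow> bool"
  assumes "AE x in lborel. P x" and "0 < s"
  shows "AE x in lborel. P (s *\<^sub>R x)"
proof -
  obtain N where N: "{x. \<not> P x} \<subseteq> N" "N \<in> sets borel" "emeasure lborel N = 0"
    using assms(1) by (auto elim!: AE_E)
  note [measurable] = N(2)
  have "(\<integral>\<^sup>+x. indicator N (s *\<^sub>R x) \<partial>lborel) = 0"
    using N assms(2) by (subst nn_integral_dilation) auto
  then have "AE x in lborel. indicator N (s *\<^sub>R x) = (0::ennreal)"
    by (subst (asm) nn_integral_0_iff_AE) auto
  then show ?thesis
    by eventually_elim (use N(1) in \<open>auto simp: indicator_def split: if_splits\<close>)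
qed

lemma nn_integral_translation:
  fixes f :: "'a::euclidean_space \<Rightarrow> ennreal"
  assumes [measurable]: "f \<in> borel_measurable borel"
  shows "(\<integral>\<^sup>+x. f (x + y) \<partial>lborel) = (\<integral>\<^sup>+x. f x \<partial>lborel)"
  by (subst (2) lborel_distr_plus[of y, symmetric]) (simp add: nn_integral_distr add.commute)

lemma AE_translation:
  fixes P :: "'a::euclidean_space \<Rightarrow> bool"
  assumes "AE x in lborel. P x"
  shows "AE x in lborel. P (x + y)"
proof -
  obtain N where N: "{x. \<not> P x} \<subseteq> N" "N \<in> sets borel" "emeasure lborel N = 0"
    using assms(1) by (auto elim!: AE_E)
  note [measurable] = N(2)
  have "(\<integral>\<^sup>+x. indicator N (x + y) \<partial>lborel) = 0"
    using N by (subst nn_integral_translation) auto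
  then have "AE x in lborel. indicator N (x + y) = (0::ennreal)"
    by (subst (asm) nn_integral_0_iff_AE) auto
  then show ?thesis
    by eventually_elim (use N(1) in \<open>auto simp: indicator_def split: if_splits\<close>)
qed

text \<open>
  A rule for the measurability prover, for indicators of balls.
\<close>

lemma sets_borel_cball [measurable]: "cball c r \<in> sets (borel :: 'a::euclidean_space measure)"
  by (intro borel_closed closed_cball)

lemma AE_of_AE_cball:
  fixes P :: "'a::euclidean_space \<Rightarrow> bool"
  assumes "\<And>k::nat. AE x in lborel. x \<in> cball 0 (real k) \<longrightarrow> P x"
  shows "AE x in lborel. P x"
proof -
  have "AE x in lborel. \<forall>k::nat. x \<in> cball 0 (real k) \<longrightarrow> P x"
    unfolding AE_all_countable using assms by blast
  then show ?thesis
  proof eventually_elim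
    case (elim x)
    obtain k :: nat where "norm x \<le> real k" using real_arch_simple by blast
    then show ?case using elim by auto
  qed
qed

section \<open>Test functions\<close>

lemma test_function_regular:
  assumes "\<phi> \<in> test_functions"
  shows "continuous_on UNIV \<phi>" "\<And>x. \<phi> differentiable (at x)" "continuous_on UNIV (gradient \<phi>)"
proof -
  have C: "C_diff k \<phi>" for k using assms by (auto simp: test_functions_def)
  show "continuous_on UNIV \<phi>" using C[of 0] by simp
  show "\<phi> differentiable (at x)" for x using C[of 1] by simp
  show "continuous_on UNIV (gradient \<phi>)"
    using C[of 1] unfolding gradient_def by (auto intro!: continuous_on_vec_lambda)
qed

lemma frechet_derivative_eq_gradient:
  assumes "f differentiable (at x)"
  shows "frechet_derivative f (at x) e = gradient f x \<bullet> e"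
proof -
  interpret linear "frechet_derivative f (at x)"
    using linear_frechet_derivative[OF assms] .
  have "frechet_derivative f (at x) e = frechet_derivative f (at x) (\<Sum>i\<in>UNIV. (e $ i) *\<^sub>R axis i 1)"
    using basis_expansion[of e] by (simp add: scalar_mult_eq_scaleR)
  also have "\<dots> = gradient f x \<bullet> e"
    by (simp add: sum scale gradient_def partial_deriv_def inner_vec_def mult.commute)
  finally show ?thesis .
qed

text \<open>
  Off the closure of the set where \<open>\<phi>\<close> is nonzero, \<open>\<phi>\<close> vanishes on a neighbourhood, so its
  derivative vanishes there.
\<close>

lemma test_function_support:
  assumes "\<phi> \<in> test_functions"
  obtains R where "\<And>x. R < norm x \<Longrightarrow> gradient \<phi> x = 0"
proof -
  let ?S = "closure {x. \<phi> x \<noteq> 0}"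
  have "bounded ?S" using assms by (auto simp: test_functions_def compact_imp_bounded)
  then obtain R where R: "\<And>x. x \<in> ?S \<Longrightarrow> norm x \<le> R" by (auto simp: bounded_iff)
  have "gradient \<phi> x = 0" if "R < norm x" for x
  proof -
    have x: "x \<in> - ?S" using R[of x] that by auto
    have "((\<lambda>_. 0) has_derivative (\<lambda>_. 0)) (at x)" by simp
    then have "(\<phi> has_derivative (\<lambda>_. 0)) (at x)"
      by (rule has_derivative_transform_within_open[OF _ _ x])
         (use closure_subset[of "{x. \<phi> x \<noteq> 0}"] in auto)
    then have "frechet_derivative \<phi> (at x) = (\<lambda>_. 0)"
      using frechet_derivative_at by metis
    then show ?thesis by (simp add: gradient_def partial_deriv_def vec_eq_iff)
  qed
  then show thesis using that by blast
qed

lemma C_diff_dilation: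
  assumes "C_diff k f"
  shows "C_diff k (\<lambda>x. c * f (s *\<^sub>R x))"
  using assms
proof (induction k arbitrary: c f)
  case 0
  then show ?case
    by (auto intro!: continuous_intros continuous_on_compose2[of UNIV f])
next
  case (Suc k)
  have D: "((\<lambda>x. c * f (s *\<^sub>R x)) has_derivative
      (\<lambda>e. c * frechet_derivative f (at (s *\<^sub>R x)) (s *\<^sub>R e))) (at x)" for x
  proof -
    have "(f has_derivative frechet_derivative f (at (s *\<^sub>R x))) (at (s *\<^sub>R x))"
      using Suc.prems by (simp add: frechet_derivative_works[symmetric])
    then have "((\<lambda>x. f (s *\<^sub>R x)) has_derivative
        (\<lambda>e. frechet_derivative f (at (s *\<^sub>R x)) (s *\<^sub>R e))) (at x)"
      by (rule has_derivative_compose[rotated]) (auto intro!: derivative_eq_intros)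
    then show ?thesis by (auto intro!: derivative_eq_intros)
  qed
  have "partial_deriv i (\<lambda>x. c * f (s *\<^sub>R x)) = (\<lambda>x. (c * s) * partial_deriv i f (s *\<^sub>R x))" for i
  proof
    fix x
    have "linear (frechet_derivative f (at (s *\<^sub>R x)))"
      using Suc.prems by (simp add: linear_frechet_derivative)
    then show "partial_deriv i (\<lambda>x. c * f (s *\<^sub>R x)) x = (c * s) * partial_deriv i f (s *\<^sub>R x)"
      using frechet_derivative_at[OF D[of x], symmetric]
      by (simp add: partial_deriv_def linear_cmul)
  qed
  moreover have "(\<lambda>x. c * f (s *\<^sub>R x)) differentiable (at x)" for x
    using D differentiable_def by blast
  ultimately show ?case using Suc by simp
qed

lemma gradient_dilation:
  assumes "f differentiable (at (s *\<^sub>R x))"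
  shows "gradient (\<lambda>x. c * f (s *\<^sub>R x)) x = (c * s) *\<^sub>R gradient f (s *\<^sub>R x)"
proof -
  have "(f has_derivative frechet_derivative f (at (s *\<^sub>R x))) (at (s *\<^sub>R x))"
    using assms by (simp add: frechet_derivative_works[symmetric])
  then have "((\<lambda>x. f (s *\<^sub>R x)) has_derivative
      (\<lambda>e. frechet_derivative f (at (s *\<^sub>R x)) (s *\<^sub>R e))) (at x)"
    by (rule has_derivative_compose[rotated]) (auto intro!: derivative_eq_intros)
  then have D: "((\<lambda>x. c * f (s *\<^sub>R x)) has_derivative
      (\<lambda>e. c * frechet_derivative f (at (s *\<^sub>R x)) (s *\<^sub>R e))) (at x)"
    by (auto intro!: derivative_eq_intros)
  show ?thesis
    using frechet_derivative_at[OF D, symmetric] linear_frechet_derivative[OF assms]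
    by (simp add: gradient_def partial_deriv_def linear_cmul vec_eq_iff)
qed

lemma test_functions_dilation:
  assumes "\<phi> \<in> test_functions" and "0 < s"
  shows "(\<lambda>x. c * \<phi> (s *\<^sub>R x)) \<in> test_functions"
proof -
  let ?S = "{x. \<phi> x \<noteq> 0}"
  have "{x. c * \<phi> (s *\<^sub>R x) \<noteq> 0} \<subseteq> (\<lambda>x. (1 / s) *\<^sub>R x) ` ?S"
  proof
    fix x assume "x \<in> {x. c * \<phi> (s *\<^sub>R x) \<noteq> 0}"
    then show "x \<in> (\<lambda>x. (1 / s) *\<^sub>R x) ` ?S"
      using \<open>0 < s\<close> by (intro image_eqI[of _ _ "s *\<^sub>R x"]) auto
  qed
  moreover have "bounded ?S"
    using assms(1) by (auto simp: test_functions_def compact_closure)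
  ultimately have "bounded {x. c * \<phi> (s *\<^sub>R x) \<noteq> 0}"
    using bounded_scaling bounded_subset by blast
  then show ?thesis
    using assms(1) by (auto simp: test_functions_def compact_closure intro: C_diff_dilation)
qed

section \<open>Integrating a weighted gradient along segments\<close>

text \<open>
  Since \<open>a \<ge> 0\<close>, the weight \<open>norm x powr (- a)\<close> is bounded below on a ball, so the weighted square
  norm controls the \<open>L\<^sup>1\<close> norm on the ball, by the Cauchy-Schwarz inequality.
\<close>

lemma nn_integral_ball_le_weighted:
  fixes F :: "real^'n::finite \<Rightarrow> real^'n"
  assumes [measurable]: "F \<in> borel_measurable borel" and a: "0 \<le> a" "0 \<le> R"
  shows "(\<integral>\<^sup>+x\<in>cball 0 R. ennreal (norm (F x)) \<partial>lborel)\<^sup>2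
    \<le> ennreal (R powr (2 * a)) * emeasure lborel (cball (0::real^'n) R)
      * (\<integral>\<^sup>+x. ennreal ((norm x powr (- a) * norm (F x))\<^sup>2) \<partial>lborel)"
proof -
  let ?f = "\<lambda>x::real^'n. ennreal (R powr a) * indicator (cball 0 R) x"
  let ?g = "\<lambda>x. ennreal (norm x powr (- a) * norm (F x))"
  have "(\<integral>\<^sup>+x\<in>cball 0 R. ennreal (norm (F x)) \<partial>lborel) \<le> (\<integral>\<^sup>+x. ?f x * ?g x \<partial>lborel)"
  proof (intro nn_integral_mono_AE)
    show "AE x in lborel. ennreal (norm (F x)) * indicator (cball 0 R) x \<le> ?f x * ?g x"
      using AE_lborel_singleton[of "0::real^'n"]
    proof eventually_elim
      case (elim x)
      show ?case
      proof (cases "x \<in> cball 0 R")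
        case True
        have "norm (F x) = norm x powr a * (norm x powr (- a) * norm (F x))"
          using elim by (simp add: powr_minus)
        also have "\<dots> \<le> R powr a * (norm x powr (- a) * norm (F x))"
          using True a by (intro mult_right_mono powr_mono2) auto
        finally show ?thesis using True by (simp add: ennreal_mult[symmetric] ennreal_leI)
      qed simp
    qed
  qed
  then have "(\<integral>\<^sup>+x\<in>cball 0 R. ennreal (norm (F x)) \<partial>lborel)\<^sup>2 \<le> (\<integral>\<^sup>+x. ?f x * ?g x \<partial>lborel)\<^sup>2"
    by (intro power_mono) auto
  also have "\<dots> \<le> (\<integral>\<^sup>+x. ?f x ^ 2 \<partial>lborel) * (\<integral>\<^sup>+x. ?g x ^ 2 \<partial>lborel)"
    by (rule Cauchy_Schwarz_nn_integral[of ?f lborel ?g]) auto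
  also have "(\<integral>\<^sup>+x. ?f x ^ 2 \<partial>lborel) = (\<integral>\<^sup>+x. ennreal (R powr (2 * a)) * indicator (cball (0::real^'n) R) x \<partial>lborel)"
  proof (intro nn_integral_cong)
    have "(R powr a)\<^sup>2 = R powr (2 * a)" by (simp add: power2_eq_square powr_add[symmetric])
    then show "?f x ^ 2 = ennreal (R powr (2 * a)) * indicator (cball (0::real^'n) R) x" for x
      by (auto simp: indicator_def ennreal_power)
  qed
  also have "\<dots> = ennreal (R powr (2 * a)) * emeasure lborel (cball (0::real^'n) R)"
    by (rule nn_integral_cmult_indicator) simp
  also have "(\<integral>\<^sup>+x. ?g x ^ 2 \<partial>lborel) = (\<integral>\<^sup>+x. ennreal ((norm x powr (- a) * norm (F x))\<^sup>2) \<partial>lborel)"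
    by (intro nn_integral_cong) (simp add: ennreal_power)
  finally show ?thesis .
qed

lemma weighted_convergence_imp_L1_ball:
  fixes F :: "nat \<Rightarrow> real^'n::finite \<Rightarrow> real^'n"
  assumes "\<And>n. F n \<in> borel_measurable borel" and "0 \<le> a" "0 \<le> R"
    and "(\<lambda>n. \<integral>\<^sup>+x. ennreal ((norm x powr (- a) * norm (F n x))\<^sup>2) \<partial>lborel) \<longlonglongrightarrow> 0"
  shows "(\<lambda>n. \<integral>\<^sup>+x\<in>cball 0 R. ennreal (norm (F n x)) \<partial>lborel) \<longlonglongrightarrow> 0"
proof -
  let ?c = "ennreal (R powr (2 * a)) * emeasure lborel (cball (0::real^'n) R)"
  let ?I = "\<lambda>n. \<integral>\<^sup>+x\<in>cball 0 R. ennreal (norm (F n x)) \<partial>lborel"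
  have "?c < top" using emeasure_lborel_cball_finite[of "0::real^'n" R]
    by (auto simp: ennreal_mult_less_top)
  then have "(\<lambda>n. ?c * (\<integral>\<^sup>+x. ennreal ((norm x powr (- a) * norm (F n x))\<^sup>2) \<partial>lborel)) \<longlonglongrightarrow> ?c * 0"
    by (intro ennreal_tendsto_cmult assms)
  then have c: "(\<lambda>n. ?c * (\<integral>\<^sup>+x. ennreal ((norm x powr (- a) * norm (F n x))\<^sup>2) \<partial>lborel)) \<longlonglongrightarrow> 0"
    by simp
  have lim: "(\<lambda>n. (?I n)\<^sup>2) \<longlonglongrightarrow> 0"
  proof (rule tendsto_sandwich[OF _ _ tendsto_const c])
    show "\<forall>\<^sub>F n in sequentially. (?I n)\<^sup>2
        \<le> ?c * (\<integral>\<^sup>+x. ennreal ((norm x powr (- a) * norm (F n x))\<^sup>2) \<partial>lborel)"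
      by (intro always_eventually allI nn_integral_ball_le_weighted assms)
  qed simp
  show ?thesis
  proof (rule order_tendstoI)
    fix e :: ennreal assume "0 < e"
    then have "0 < e\<^sup>2" by (simp add: power2_eq_square ennreal_zero_less_mult_iff)
    then have "\<forall>\<^sub>F n in sequentially. (?I n)\<^sup>2 < e\<^sup>2" by (rule order_tendstoD[OF lim])
    then show "\<forall>\<^sub>F n in sequentially. ?I n < e"
    proof eventually_elim
      case (elim n)
      show ?case
      proof (rule ccontr)
        assume "\<not> ?I n < e"
        then have "e\<^sup>2 \<le> (?I n)\<^sup>2" by (intro power_mono) auto
        then show False using elim by simp
      qed
    qed
  qed simp
qed

text \<open>
  If \<open>g\<close> is not integrable, then neither is \<open>f - g\<close> and the right-hand side is infinite.  So the
  default value of the integral of \<open>g\<close> does no harm, and the lemma can be applied on every segment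
  without checking that the gradient is integrable there.
\<close>

lemma integrable_diff_norm_integral_le:
  fixes f g :: "'a \<Rightarrow> real"
  assumes f: "integrable M f" and [measurable]: "g \<in> borel_measurable M"
  shows "ennreal \<bar>(\<integral>x. f x \<partial>M) - (\<integral>x. g x \<partial>M)\<bar> \<le> (\<integral>\<^sup>+x. ennreal \<bar>f x - g x\<bar> \<partial>M)"
proof (cases "integrable M g")
  case True
  then have "(\<integral>x. f x \<partial>M) - (\<integral>x. g x \<partial>M) = (\<integral>x. f x - g x \<partial>M)" using f by simp
  then show ?thesis
    using integral_norm_bound_ennreal[of M "\<lambda>x. f x - g x"] f True by simp
next
  case False
  have "\<not> integrable M (\<lambda>x. f x - g x)"
  proof
    assume "integrable M (\<lambda>x. f x - g x)"
    from Bochner_Integration.integrable_diff[OF f this] show False using False by simp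
  qed
  then have "\<not> (\<integral>\<^sup>+x. ennreal \<bar>f x - g x\<bar> \<partial>M) < top"
    using f by (auto simp: integrable_iff_bounded)
  then have "(\<integral>\<^sup>+x. ennreal \<bar>f x - g x\<bar> \<partial>M) = top"
    using top.not_eq_extremum by blast
  then show ?thesis by simp
qed

lemma test_function_increment:
  assumes \<phi>: "\<phi> \<in> test_functions" and "0 \<le> h"
  shows "integrable lborel (\<lambda>t. indicator {0..h} t * (gradient \<phi> (x + t *\<^sub>R e) \<bullet> e))"
    and "(\<integral>t. indicator {0..h} t * (gradient \<phi> (x + t *\<^sub>R e) \<bullet> e) \<partial>lborel) = \<phi> (x + h *\<^sub>R e) - \<phi> x"
proof -
  have D: "((\<lambda>t. \<phi> (x + t *\<^sub>R e)) has_real_derivative gradient \<phi> (x + t *\<^sub>R e) \<bullet> e) (at t)" for t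
  proof -
    have "(\<phi> has_derivative (\<lambda>y. gradient \<phi> (x + t *\<^sub>R e) \<bullet> y)) (at (x + t *\<^sub>R e))"
      using frechet_derivative_works[THEN iffD1, OF test_function_regular(2)[OF \<phi>, of "x + t *\<^sub>R e"]]
      unfolding frechet_derivative_eq_gradient[OF test_function_regular(2)[OF \<phi>], abs_def] .
    then have "((\<lambda>t. \<phi> (x + t *\<^sub>R e)) has_derivative (\<lambda>d. gradient \<phi> (x + t *\<^sub>R e) \<bullet> (d *\<^sub>R e))) (at t)"
      by (rule has_derivative_compose[rotated]) (auto intro!: derivative_eq_intros)
    then show ?thesis by (simp add: has_field_derivative_def mult.commute[of _ "_ \<bullet> _"])
  qed
  have C: "continuous_on {0..h} (\<lambda>t. gradient \<phi> (x + t *\<^sub>R e) \<bullet> e)"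
    by (intro continuous_intros continuous_on_compose2[OF test_function_regular(3)[OF \<phi>]]) auto
  have V: "((\<lambda>t. \<phi> (x + t *\<^sub>R e)) has_vector_derivative gradient \<phi> (x + t *\<^sub>R e) \<bullet> e)
      (at t within {0..h})" for t
    using has_field_derivative_at_within[OF D[of t]]
    by (simp add: has_real_derivative_iff_has_vector_derivative)
  have "has_bochner_integral lborel (\<lambda>t. indicator {0..h} t *\<^sub>R (gradient \<phi> (x + t *\<^sub>R e) \<bullet> e))
      (\<phi> (x + h *\<^sub>R e) - \<phi> (x + 0 *\<^sub>R e))"
    by (rule has_bochner_integral_FTC_Icc[OF \<open>0 \<le> h\<close> V C])
  then show "integrable lborel (\<lambda>t. indicator {0..h} t * (gradient \<phi> (x + t *\<^sub>R e) \<bullet> e))"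
    and "(\<integral>t. indicator {0..h} t * (gradient \<phi> (x + t *\<^sub>R e) \<bullet> e) \<partial>lborel) = \<phi> (x + h *\<^sub>R e) - \<phi> x"
    by (auto simp: has_bochner_integral_iff)
qed

text \<open>
  Tonelli: for each \<open>t\<close> the inner integral is an integral over a translate of the ball, and all
  these translates lie in one larger ball.
\<close>

lemma nn_integral_segments_le:
  fixes F :: "real^'n::finite \<Rightarrow> ennreal"
  assumes [measurable]: "F \<in> borel_measurable borel" and "0 \<le> h"
  shows "(\<integral>\<^sup>+x\<in>cball 0 R. (\<integral>\<^sup>+t\<in>{0..h}. F (x + t *\<^sub>R e) \<partial>lborel) \<partial>lborel)
     \<le> ennreal h * (\<integral>\<^sup>+x\<in>cball 0 (R + h * norm e). F x \<partial>lborel)"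
proof -
  have "(\<integral>\<^sup>+x\<in>cball 0 R. (\<integral>\<^sup>+t\<in>{0..h}. F (x + t *\<^sub>R e) \<partial>lborel) \<partial>lborel)
      = (\<integral>\<^sup>+x. (\<integral>\<^sup>+t. indicator {0..h} t * (F (x + t *\<^sub>R e) * indicator (cball 0 R) x) \<partial>lborel) \<partial>lborel)"
    by (intro nn_integral_cong, subst nn_integral_multc[symmetric]) (auto simp: mult_ac)
  also have "\<dots> = (\<integral>\<^sup>+t. (\<integral>\<^sup>+x. indicator {0..h} t * (F (x + t *\<^sub>R e) * indicator (cball 0 R) x) \<partial>lborel) \<partial>lborel)"
    by (rule lborel_pair.Fubini') measurable
  also have "\<dots> \<le> (\<integral>\<^sup>+t. indicator {0..h} t * (\<integral>\<^sup>+x\<in>cball 0 (R + h * norm e). F x \<partial>lborel) \<partial>(lborel::real measure))"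
  proof (intro nn_integral_mono)
    fix t :: real
    have "(\<integral>\<^sup>+x. F (x + t *\<^sub>R e) * indicator (cball 0 R) x \<partial>lborel)
        \<le> (\<integral>\<^sup>+x\<in>cball 0 (R + h * norm e). F x \<partial>lborel)" if t: "t \<in> {0..h}"
    proof -
      have "(\<integral>\<^sup>+x. F (x + t *\<^sub>R e) * indicator (cball 0 R) x \<partial>lborel)
          \<le> (\<integral>\<^sup>+x. F (x + t *\<^sub>R e) * indicator (cball 0 (R + h * norm e)) (x + t *\<^sub>R e) \<partial>lborel)"
      proof (intro nn_integral_mono mult_left_mono)
        fix x :: "real^'n"
        have "norm (x + t *\<^sub>R e) \<le> R + h * norm e" if "norm x \<le> R"
          using norm_triangle_ineq[of x "t *\<^sub>R e"] that t mult_right_mono[of t h "norm e"] by auto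
        then show "indicator (cball 0 R) x \<le> (indicator (cball 0 (R + h * norm e)) (x + t *\<^sub>R e) :: ennreal)"
          by (auto simp: indicator_def)
      qed simp
      then show ?thesis
        using nn_integral_translation[of "\<lambda>x. F x * indicator (cball 0 (R + h * norm e)) x" "t *\<^sub>R e"] by simp
    qed
    then show "(\<integral>\<^sup>+x. indicator {0..h} t * (F (x + t *\<^sub>R e) * indicator (cball 0 R) x) \<partial>lborel)
        \<le> indicator {0..h} t * (\<integral>\<^sup>+x\<in>cball 0 (R + h * norm e). F x \<partial>lborel)"
      by (auto simp: indicator_def)
  qed
  also have "\<dots> = ennreal h * (\<integral>\<^sup>+x\<in>cball 0 (R + h * norm e). F x \<partial>lborel)"
    using \<open>0 \<le> h\<close> by (simp add: nn_integral_multc)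
  finally show ?thesis .
qed

text \<open>
  The fundamental theorem of calculus passes to the limit.  For the approximating test functions it
  is exact; integrated over a ball, the errors on both sides are \<open>L\<^sup>1\<close> distances on a larger ball,
  and these tend to zero.
\<close>

lemma D_limit_increment:
  fixes u :: "real^'n::finite \<Rightarrow> real"
  assumes "D_limit a u G" and "0 \<le> a" "0 \<le> h"
  shows "AE x in lborel. u (x + h *\<^sub>R e) - u x = (\<integral>t. indicator {0..h} t * (G (x + t *\<^sub>R e) \<bullet> e) \<partial>lborel)"
proof -
  have [measurable]: "u \<in> borel_measurable borel" "G \<in> borel_measurable borel"
    using assms(1) by (auto simp: D_limit_def)
  obtain \<phi> where \<phi>: "\<And>n. \<phi> n \<in> test_functions"
    and \<phi>u: "\<And>K. compact K \<Longrightarrow> (\<lambda>n. \<integral>\<^sup>+x\<in>K. ennreal \<bar>\<phi> n x - u x\<bar> \<partial>lborel) \<longlonglongrightarrow> 0"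
    and \<phi>G: "(\<lambda>n. \<integral>\<^sup>+x. ennreal ((norm x powr (- a) * norm (gradient (\<phi> n) x - G x))\<^sup>2) \<partial>lborel) \<longlonglongrightarrow> 0"
    using assms(1) by (auto simp: D_limit_def)
  have [measurable]: "\<phi> n \<in> borel_measurable borel" "gradient (\<phi> n) \<in> borel_measurable borel" for n
    using test_function_regular[OF \<phi>] by (auto intro: borel_measurable_continuous_onI)
  define J where "J x = (\<integral>t. indicator {0..h} t * (G (x + t *\<^sub>R e) \<bullet> e) \<partial>lborel)" for x
  have [measurable]: "J \<in> borel_measurable borel" unfolding J_def by measurable
  let ?D = "\<lambda>x. ennreal \<bar>u (x + h *\<^sub>R e) - u x - J x\<bar>"
  have "AE x in lborel. x \<in> cball 0 R \<longrightarrow> u (x + h *\<^sub>R e) - u x = J x" if "0 \<le> R" for R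
  proof -
    let ?R = "R + h * norm e"
    let ?I1 = "\<lambda>n. \<integral>\<^sup>+x\<in>cball 0 ?R. ennreal \<bar>\<phi> n x - u x\<bar> \<partial>lborel"
    let ?I2 = "\<lambda>n. \<integral>\<^sup>+x\<in>cball 0 ?R. ennreal (norm (gradient (\<phi> n) x - G x)) \<partial>lborel"
    have R: "0 \<le> ?R" "R \<le> ?R" using that assms by auto
    have bound: "(\<integral>\<^sup>+x\<in>cball 0 R. ?D x \<partial>lborel) \<le> 2 * ?I1 n + ennreal (h * norm e) * ?I2 n" for n
    proof -
      let ?A = "\<lambda>x. ennreal \<bar>\<phi> n (x + h *\<^sub>R e) - u (x + h *\<^sub>R e)\<bar>"
      let ?B = "\<lambda>x. ennreal \<bar>\<phi> n x - u x\<bar>"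
      let ?F = "\<lambda>x. ennreal (norm (gradient (\<phi> n) x - G x))"
      let ?C = "\<lambda>x. ennreal (norm e) * (\<integral>\<^sup>+t\<in>{0..h}. ?F (x + t *\<^sub>R e) \<partial>lborel)"
      have "?D x \<le> ?A x + ?B x + ?C x" for x
      proof -
        let ?p = "\<phi> n (x + h *\<^sub>R e) - \<phi> n x"
        have "ennreal \<bar>?p - J x\<bar> \<le> (\<integral>\<^sup>+t. ennreal \<bar>indicator {0..h} t * (gradient (\<phi> n) (x + t *\<^sub>R e) \<bullet> e)
                 - indicator {0..h} t * (G (x + t *\<^sub>R e) \<bullet> e)\<bar> \<partial>lborel)"
          unfolding J_def test_function_increment(2)[OF \<phi> \<open>0 \<le> h\<close>, of n x e, symmetric]
          by (intro integrable_diff_norm_integral_le test_function_increment \<phi> \<open>0 \<le> h\<close>) measurable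
        also have "\<dots> \<le> (\<integral>\<^sup>+t. ennreal (norm e) * (?F (x + t *\<^sub>R e) * indicator {0..h} t) \<partial>lborel)"
          using Cauchy_Schwarz_ineq2[of _ e, unfolded mult.commute[of _ "norm e"]]
          by (intro nn_integral_mono)
             (auto simp: indicator_def inner_diff_left[symmetric] ennreal_mult[symmetric])
        also have "\<dots> = ?C x" by (intro nn_integral_cmult) measurable
        finally have p: "ennreal \<bar>?p - J x\<bar> \<le> ?C x" .
        have "?D x \<le> ennreal (\<bar>\<phi> n (x + h *\<^sub>R e) - u (x + h *\<^sub>R e)\<bar> + \<bar>\<phi> n x - u x\<bar> + \<bar>?p - J x\<bar>)"
          by (intro ennreal_leI) linarith
        then show ?thesis using p by (simp add: order_trans[OF _ add_left_mono])
      qed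
      then have "(\<integral>\<^sup>+x\<in>cball 0 R. ?D x \<partial>lborel)
          \<le> (\<integral>\<^sup>+x\<in>cball 0 R. (?A x + ?B x + ?C x) \<partial>lborel)"
        by (intro nn_integral_mono mult_right_mono) auto
      also have "\<dots> = (\<integral>\<^sup>+x\<in>cball 0 R. ?A x \<partial>lborel) + (\<integral>\<^sup>+x\<in>cball 0 R. ?B x \<partial>lborel)
          + (\<integral>\<^sup>+x\<in>cball 0 R. ?C x \<partial>lborel)"
        by (simp add: distrib_right nn_integral_add)
      also have "(\<integral>\<^sup>+x\<in>cball 0 R. ?A x \<partial>lborel) \<le> ?I1 n"
      proof -
        have "(\<integral>\<^sup>+x\<in>cball 0 R. ?A x \<partial>lborel)
            \<le> (\<integral>\<^sup>+x. ?B (x + h *\<^sub>R e) * indicator (cball 0 ?R) (x + h *\<^sub>R e) \<partial>lborel)"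
        proof (intro nn_integral_mono mult_left_mono)
          fix x :: "real^'n"
          have "norm (x + h *\<^sub>R e) \<le> ?R" if "norm x \<le> R"
            using norm_triangle_ineq[of x "h *\<^sub>R e"] that \<open>0 \<le> h\<close> by auto
          then show "indicator (cball 0 R) x \<le> (indicator (cball 0 ?R) (x + h *\<^sub>R e) :: ennreal)"
            by (auto simp: indicator_def)
        qed simp
        then show ?thesis
          using nn_integral_translation[of "\<lambda>x. ?B x * indicator (cball 0 ?R) x" "h *\<^sub>R e"] by simp
      qed
      also have "(\<integral>\<^sup>+x\<in>cball 0 R. ?B x \<partial>lborel) \<le> ?I1 n"
        using R by (intro nn_integral_mono mult_left_mono) (auto simp: indicator_def)
      also have "(\<integral>\<^sup>+x\<in>cball 0 R. ?C x \<partial>lborel) \<le> ennreal (h * norm e) * ?I2 n"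
      proof -
        have "(\<integral>\<^sup>+x\<in>cball 0 R. ?C x \<partial>lborel) = ennreal (norm e) *
            (\<integral>\<^sup>+x\<in>cball 0 R. (\<integral>\<^sup>+t\<in>{0..h}. ?F (x + t *\<^sub>R e) \<partial>lborel) \<partial>lborel)"
          by (subst nn_integral_cmult[symmetric]) (auto simp: mult.assoc)
        also have "\<dots> \<le> ennreal (norm e) * (ennreal h * ?I2 n)"
          using \<open>0 \<le> h\<close> by (intro mult_left_mono nn_integral_segments_le) auto
        finally show ?thesis using \<open>0 \<le> h\<close> by (simp add: ennreal_mult mult_ac)
      qed
      finally show ?thesis by (simp add: mult_2 add_mono)
    qed
    have "(\<lambda>n. 2 * ?I1 n + ennreal (h * norm e) * ?I2 n) \<longlonglongrightarrow> 2 * 0 + ennreal (h * norm e) * 0"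
      using R by (intro tendsto_add ennreal_tendsto_cmult \<phi>u weighted_convergence_imp_L1_ball[OF _ \<open>0 \<le> a\<close> _ \<phi>G]) auto
    then have "(\<integral>\<^sup>+x\<in>cball 0 R. ?D x \<partial>lborel) \<le> 0"
      using bound by (intro LIMSEQ_le_const) auto
    then have "(\<integral>\<^sup>+x\<in>cball 0 R. ?D x \<partial>lborel) = 0" by simp
    moreover have "(\<lambda>x. ?D x * indicator (cball 0 R) x) \<in> borel_measurable lborel" by measurable
    ultimately have "AE x in lborel. ?D x * indicator (cball 0 R) x = 0"
      using nn_integral_0_iff_AE by blast
    then show ?thesis by eventually_elim (auto simp: indicator_def ennreal_eq_0_iff)
  qed
  then have "AE x in lborel. u (x + h *\<^sub>R e) - u x = J x"
    by (rule AE_of_AE_cball) simp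
  then show ?thesis unfolding J_def .
qed

section \<open>Finiteness of the weighted gradient norm\<close>

text \<open>
  Cut the ball into dyadic shells.  By dilation the integral over a shell is \<open>2 powr (c - n)\<close> times the
  integral over the next larger shell, where \<open>n\<close> is the dimension, so the integrals are summed by a
  geometric series.
\<close>

lemma nn_integral_ball_norm_powr_finite:
  assumes "0 \<le> c" "c < real DIM('a)" "0 < R"
  shows "(\<integral>\<^sup>+x\<in>cball (0::'a::euclidean_space) R. ennreal (norm x powr (- c)) \<partial>lborel) < \<infinity>"
proof -
  define A :: "nat \<Rightarrow> 'a set" where "A k = {x. R / 2 ^ Suc k < norm x \<and> norm x \<le> R / 2 ^ k}" for k
  have [measurable]: "A k \<in> sets borel" for k unfolding A_def by measurable
  let ?f = "\<lambda>x::'a. ennreal (norm x powr (- c))"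
  define \<theta> where "\<theta> = 2 powr (c - real DIM('a))"
  have \<theta>: "0 < \<theta>" "\<theta> < 1" using assms by (auto simp: \<theta>_def powr_less_one)
  let ?M = "\<integral>\<^sup>+x\<in>A 0. ?f x \<partial>lborel"
  have M: "?M < \<infinity>"
  proof -
    have "?M \<le> (\<integral>\<^sup>+x. ennreal ((R / 2) powr (- c)) * indicator (cball 0 R) (x::'a) \<partial>lborel)"
      using assms by (intro nn_integral_mono)
        (auto simp: A_def indicator_def intro!: ennreal_leI powr_mono2')
    also have "\<dots> = ennreal ((R / 2) powr (- c)) * emeasure lborel (cball (0::'a) R)"
      by (rule nn_integral_cmult_indicator) simp
    also have "\<dots> < \<infinity>"
      using emeasure_lborel_cball_finite[of "0::'a" R] by (auto simp: ennreal_mult_less_top)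
    finally show ?thesis .
  qed
  have shell: "(\<integral>\<^sup>+x\<in>A k. ?f x \<partial>lborel) = ennreal (\<theta> ^ k) * ?M" for k
  proof (induction k)
    case (Suc k)
    have "?f x * indicator (A (Suc k)) x = ennreal (2 powr c) * (?f (2 *\<^sub>R x) * indicator (A k) (2 *\<^sub>R x))" for x
    proof -
      have "norm x powr (- c) = 2 powr c * norm (2 *\<^sub>R x) powr (- c)"
        by (simp add: powr_mult powr_minus)
      moreover have "x \<in> A (Suc k) \<longleftrightarrow> 2 *\<^sub>R x \<in> A k"
        by (auto simp: A_def field_simps)
      ultimately show ?thesis by (auto simp: indicator_def ennreal_mult[symmetric])
    qed
    then have "(\<integral>\<^sup>+x\<in>A (Suc k). ?f x \<partial>lborel)
        = ennreal (2 powr c) * (\<integral>\<^sup>+x. ?f (2 *\<^sub>R x) * indicator (A k) (2 *\<^sub>R x) \<partial>lborel)"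
      by (simp only: , subst nn_integral_cmult) (auto intro: nn_integral_cong)
    also have "\<dots> = ennreal (2 powr c) * (ennreal (2 powr (- real DIM('a))) * (\<integral>\<^sup>+x\<in>A k. ?f x \<partial>lborel))"
      by (subst nn_integral_dilation[of "\<lambda>x. ?f x * indicator (A k) x"]) auto
    also have "\<dots> = ennreal (\<theta> ^ Suc k) * ?M"
    proof -
      have "2 powr c * 2 powr (- real DIM('a)) = \<theta>" by (simp add: \<theta>_def powr_add[symmetric])
      then have "\<theta> ^ Suc k = 2 powr c * (2 powr (- real DIM('a)) * \<theta> ^ k)" by simp
      then show ?thesis
        unfolding Suc using less_imp_le[OF \<theta>(1)] by (simp only: ennreal_mult zero_le_power powr_ge_zero
            mult_nonneg_nonneg mult.assoc)
    qed
    finally show ?case .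
  qed simp
  have cover: "?f x * indicator (cball 0 R) x \<le> (\<Sum>k. ?f x * indicator (A k) x)" if "x \<noteq> 0" for x
  proof (cases "x \<in> cball 0 R")
    case True
    have "\<exists>k. R / 2 ^ k < norm x"
      using real_arch_pow[of 2 "R / norm x"] that by (auto simp: field_simps)
    then obtain k where k: "R / 2 ^ k < norm x" "\<And>j. j < k \<Longrightarrow> norm x \<le> R / 2 ^ j"
      using exists_least_iff[of "\<lambda>k. R / 2 ^ k < norm x"] by (auto simp: not_less)
    with True obtain j where "k = Suc j" by (cases k) auto
    with k have "x \<in> A j" by (auto simp: A_def)
    then have "?f x * indicator (cball 0 R) x = (\<Sum>k\<in>{j}. ?f x * indicator (A k) x)" using True by simp
    also have "\<dots> \<le> (\<Sum>k. ?f x * indicator (A k) x)" by (intro sum_le_suminf) auto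
    finally show ?thesis .
  qed simp
  have "(\<integral>\<^sup>+x\<in>cball 0 R. ?f x \<partial>lborel) \<le> (\<integral>\<^sup>+x. (\<Sum>k. ?f x * indicator (A k) x) \<partial>lborel)"
  proof (intro nn_integral_mono_AE)
    show "AE x in lborel. ?f x * indicator (cball 0 R) x \<le> (\<Sum>k. ?f x * indicator (A k) x)"
      using AE_lborel_singleton[of "0::'a"] by eventually_elim (rule cover)
  qed
  also have "\<dots> = (\<Sum>k. \<integral>\<^sup>+x\<in>A k. ?f x \<partial>lborel)"
    by (rule nn_integral_suminf) measurable
  also have "\<dots> = (\<Sum>k. ennreal (\<theta> ^ k) * ?M)"
    by (rule suminf_cong) (rule shell)
  also have "\<dots> = (\<Sum>k. ennreal (\<theta> ^ k)) * ?M"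
    by (rule ennreal_suminf_multc)
  also have "(\<Sum>k. ennreal (\<theta> ^ k)) = ennreal (\<Sum>k. \<theta> ^ k)"
    using \<theta> by (intro suminf_ennreal2 summable_geometric) auto
  also have "ennreal (\<Sum>k. \<theta> ^ k) * ?M < \<infinity>"
    using M ennreal_less_top by (simp only: ennreal_mult_less_top infinity_ennreal_def simp_thms)
  finally show ?thesis .
qed

lemma test_function_weighted_gradient_finite:
  fixes \<phi> :: "real^'n::finite \<Rightarrow> real"
  assumes \<phi>: "\<phi> \<in> test_functions" and a: "0 \<le> a" "2 * a < real CARD('n)"
  shows "(\<integral>\<^sup>+x. ennreal ((norm x powr (- a) * norm (gradient \<phi> x))\<^sup>2) \<partial>lborel) < \<infinity>"
proof -
  obtain R0 where R0: "\<And>x. R0 < norm x \<Longrightarrow> gradient \<phi> x = 0" using test_function_support[OF \<phi>] by blast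
  define R where "R = max R0 1"
  have R: "\<And>x. R < norm x \<Longrightarrow> gradient \<phi> x = 0" "0 < R" using R0 by (auto simp: R_def)
  have "compact (gradient \<phi> ` cball 0 R)"
    by (intro compact_continuous_image continuous_on_subset[OF test_function_regular(3)[OF \<phi>]]) auto
  then have "bounded (gradient \<phi> ` cball 0 R)" by (rule compact_imp_bounded)
  then obtain M where "\<forall>y\<in>gradient \<phi> ` cball 0 R. norm y \<le> M"
    unfolding bounded_iff by blast
  then have M: "\<And>x. x \<in> cball 0 R \<Longrightarrow> norm (gradient \<phi> x) \<le> M" by blast
  have "ennreal ((norm x powr (- a) * norm (gradient \<phi> x))\<^sup>2)
      \<le> ennreal (M\<^sup>2) * (ennreal (norm x powr (- (2 * a))) * indicator (cball 0 R) x)" for x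
  proof (cases "x \<in> cball 0 R")
    case True
    have "(norm x powr (- a))\<^sup>2 = norm x powr (- (2 * a))"
      by (simp add: power2_eq_square powr_add[symmetric])
    then have "(norm x powr (- a) * norm (gradient \<phi> x))\<^sup>2 = (norm (gradient \<phi> x))\<^sup>2 * norm x powr (- (2 * a))"
      by (simp add: power_mult_distrib)
    also have "\<dots> \<le> M\<^sup>2 * norm x powr (- (2 * a))"
      using M[OF True] by (intro mult_right_mono power_mono) auto
    finally show ?thesis using True by (simp add: ennreal_mult[symmetric] ennreal_leI)
  next
    case False
    then show ?thesis using R(1)[of x] by simp
  qed
  then have "(\<integral>\<^sup>+x. ennreal ((norm x powr (- a) * norm (gradient \<phi> x))\<^sup>2) \<partial>lborel)
      \<le> (\<integral>\<^sup>+x. ennreal (M\<^sup>2) * (ennreal (norm x powr (- (2 * a))) * indicator (cball (0::real^'n) R) x) \<partial>lborel)"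
    by (intro nn_integral_mono)
  also have "\<dots> = ennreal (M\<^sup>2) * (\<integral>\<^sup>+x\<in>cball (0::real^'n) R. ennreal (norm x powr (- (2 * a))) \<partial>lborel)"
    by (rule nn_integral_cmult) measurable
  also have "\<dots> < \<infinity>"
    using nn_integral_ball_norm_powr_finite[where 'a = "real^'n", of "2 * a" R] a R
    by (auto simp: ennreal_mult_less_top)
  finally show ?thesis .
qed

text \<open>
  Compare \<open>G\<close> with one test function whose gradient is at finite weighted distance from it.  This
  excludes that a gradient norm is zero only because the integral diverges.
\<close>

lemma D_limit_weighted_gradient_finite:
  fixes u :: "real^'n::finite \<Rightarrow> real"
  assumes "D_limit a u G" and a: "0 \<le> a" "2 * a < real CARD('n)"
  shows "(\<integral>\<^sup>+x. ennreal ((norm x powr (- a) * norm (G x))\<^sup>2) \<partial>lborel) < \<infinity>"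
proof -
  obtain \<phi> where \<phi>: "\<And>n. \<phi> n \<in> test_functions"
    and lim: "(\<lambda>n. \<integral>\<^sup>+x. ennreal ((norm x powr (- a) * norm (gradient (\<phi> n) x - G x))\<^sup>2) \<partial>lborel) \<longlonglongrightarrow> 0"
    using assms(1) by (auto simp: D_limit_def)
  have [measurable]: "G \<in> borel_measurable borel" using assms(1) by (auto simp: D_limit_def)
  obtain n where n: "(\<integral>\<^sup>+x. ennreal ((norm x powr (- a) * norm (gradient (\<phi> n) x - G x))\<^sup>2) \<partial>lborel) < 1"
    using order_tendstoD(2)[OF lim, of 1] by (auto simp: eventually_sequentially)
  have [measurable]: "gradient (\<phi> n) \<in> borel_measurable borel"
    using test_function_regular(3)[OF \<phi>] by (rule borel_measurable_continuous_onI)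
  let ?d = "\<lambda>x. ennreal ((norm x powr (- a) * norm (gradient (\<phi> n) x - G x))\<^sup>2)"
  let ?g = "\<lambda>x. ennreal ((norm x powr (- a) * norm (gradient (\<phi> n) x))\<^sup>2)"
  have "ennreal ((norm x powr (- a) * norm (G x))\<^sup>2) \<le> 2 * ?d x + 2 * ?g x" for x
  proof -
    have "(norm (G x))\<^sup>2 \<le> (norm (gradient (\<phi> n) x - G x) + norm (gradient (\<phi> n) x))\<^sup>2"
      using norm_triangle_ineq4[of "gradient (\<phi> n) x" "gradient (\<phi> n) x - G x"]
      by (intro power_mono) auto
    also have "\<dots> \<le> 2 * (norm (gradient (\<phi> n) x - G x))\<^sup>2 + 2 * (norm (gradient (\<phi> n) x))\<^sup>2"
      using sum_squares_bound[of "norm (gradient (\<phi> n) x - G x)" "norm (gradient (\<phi> n) x)"]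
      by (simp add: power2_sum)
    finally have "(norm x powr (- a))\<^sup>2 * (norm (G x))\<^sup>2
        \<le> (norm x powr (- a))\<^sup>2 * (2 * (norm (gradient (\<phi> n) x - G x))\<^sup>2 + 2 * (norm (gradient (\<phi> n) x))\<^sup>2)"
      by (rule mult_left_mono) simp
    then have "(norm x powr (- a) * norm (G x))\<^sup>2 \<le> 2 * (norm x powr (- a) * norm (gradient (\<phi> n) x - G x))\<^sup>2
        + 2 * (norm x powr (- a) * norm (gradient (\<phi> n) x))\<^sup>2"
      by (simp add: power_mult_distrib algebra_simps)
    then have "ennreal ((norm x powr (- a) * norm (G x))\<^sup>2)
        \<le> ennreal (2 * (norm x powr (- a) * norm (gradient (\<phi> n) x - G x))\<^sup>2
        + 2 * (norm x powr (- a) * norm (gradient (\<phi> n) x))\<^sup>2)" by (rule ennreal_leI)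
    then show ?thesis by (simp add: ennreal_mult)
  qed
  then have "(\<integral>\<^sup>+x. ennreal ((norm x powr (- a) * norm (G x))\<^sup>2) \<partial>lborel)
      \<le> (\<integral>\<^sup>+x. 2 * ?d x + 2 * ?g x \<partial>lborel)" by (intro nn_integral_mono)
  also have "\<dots> = 2 * (\<integral>\<^sup>+x. ?d x \<partial>lborel) + 2 * (\<integral>\<^sup>+x. ?g x \<partial>lborel)"
    by (subst nn_integral_add) (auto simp: nn_integral_cmult)
  also have "\<dots> < \<infinity>"
    using less_trans[OF n ennreal_one_less_top] test_function_weighted_gradient_finite[OF \<phi>[of n] a]
    by (simp add: ennreal_mult_less_top)
  finally show ?thesis .
qed

section \<open>Uniqueness of the gradient\<close>

text \<open>
  The primitive is continuous and vanishes at the rationals, hence everywhere.  So the positive and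
  the negative part of \<open>k\<close> are densities of measures that agree on half-lines, and such
  measures are equal.  Rational endpoints are what a countable intersection of null sets can
  provide.
\<close>

lemma AE_zero_of_integrals_zero:
  fixes k :: "real \<Rightarrow> real"
  assumes int: "integrable lborel (\<lambda>t. indicator {0..1} t * k t)" and meas[measurable]: "k \<in> borel_measurable borel"
    and zero: "\<And>r. r \<in> \<rat> \<Longrightarrow> 0 \<le> r \<Longrightarrow> (\<integral>t. indicator {0..r} t * (indicator {0..1} t * k t) \<partial>lborel) = 0"
  shows "AE t in lborel. 0 \<le> t \<longrightarrow> t \<le> 1 \<longrightarrow> k t = 0"
proof -
  define f where "f t = indicator {0..1} t * k t" for t
  have f: "integrable lborel f" and [measurable]: "f \<in> borel_measurable borel"
    using int by (auto simp: f_def[abs_def])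
  have f0: "f t = 0" if "t < 0" for t using that by (auto simp: f_def)
  have si: "integrable lborel (\<lambda>t. indicator A t * f t)" if "A \<in> sets borel" for A
    using integrable_mult_indicator[of A lborel f] f that by simp
  define F where "F s = (\<integral>t. indicator {0..s} t * f t \<partial>lborel)" for s
  have "F s = 0" if "0 \<le> s" for s
  proof -
    have "\<exists>r. \<forall>n. r n \<in> \<rat> \<and> s < r n \<and> r n < s + 1 / Suc n"
    proof (intro choice allI)
      fix n :: nat
      have "s < s + 1 / Suc n" by simp
      from Rats_dense_in_real[OF this] show "\<exists>q. q \<in> \<rat> \<and> s < q \<and> q < s + 1 / Suc n" by blast
    qed
    then obtain r where r: "\<And>n. r n \<in> \<rat>" "\<And>n. s < r n" "\<And>n. r n < s + 1 / Suc n" by blast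
    have lim: "r \<longlonglongrightarrow> s"
    proof (rule tendsto_sandwich[OF _ _ tendsto_const])
      show "(\<lambda>n. s + 1 / Suc n) \<longlonglongrightarrow> s"
        using tendsto_add[OF tendsto_const lim_inverse_n'[THEN LIMSEQ_Suc], of s] by simp
    qed (use r in \<open>auto intro!: always_eventually less_imp_le\<close>)
    have "(\<lambda>n. F (r n)) \<longlonglongrightarrow> F s"
      unfolding F_def
    proof (rule integral_dominated_convergence[where w="\<lambda>t. \<bar>f t\<bar>"])
      show "AE t in lborel. (\<lambda>n. indicator {0..r n} t * f t) \<longlonglongrightarrow> indicator {0..s} t * f t"
      proof (intro AE_I2)
        fix t
        have "\<forall>\<^sub>F n in sequentially. indicator {0..r n} t * f t = indicator {0..s} t * f t"
        proof (cases "t \<le> s")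
          case True
          then have "indicator {0..r n} t * f t = indicator {0..s} t * f t" for n
            using r(2)[of n] by (auto simp: indicator_def)
          then show ?thesis by simp
        next
          case False
          then have "\<forall>\<^sub>F n in sequentially. r n < t" using order_tendstoD(2)[OF lim] by auto
          then show ?thesis by eventually_elim (use False in \<open>auto simp: indicator_def\<close>)
        qed
        then show "(\<lambda>n. indicator {0..r n} t * f t) \<longlonglongrightarrow> indicator {0..s} t * f t"
          by (rule tendsto_eventually)
      qed
    qed (use f in \<open>auto simp: indicator_def\<close>)
    moreover have "F (r n) = 0" for n
      using zero[OF r(1)[of n]] r(2)[of n] that by (simp add: F_def f_def[abs_def])
    ultimately show ?thesis by (simp add: LIMSEQ_const_iff)
  qed
  then have F0: "F s = 0" for s
    by (cases "0 \<le> s") (auto simp: F_def)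
  \<comment> \<open>the tail beyond \<open>x\<close> is the total integral minus the part up to \<open>x\<close>; for \<open>x > 1\<close> both agree\<close>
  have tail: "(\<integral>t. indicator {x<..} t * f t \<partial>lborel) = 0" for x
  proof -
    have "(\<integral>t. indicator {x<..} t * f t \<partial>lborel) = (\<integral>t. indicator {0..max 1 x} t * f t - indicator {0..x} t * f t \<partial>lborel)"
      using f0 by (intro Bochner_Integration.integral_cong) (auto simp: indicator_def f_def)
    also have "\<dots> = F (max 1 x) - F x" unfolding F_def
      by (intro Bochner_Integration.integral_diff si) auto
    finally show ?thesis using F0 by simp
  qed
  define p where "p t = max 0 (f t)" for t
  define m where "m t = max 0 (- f t)" for t
  have fpm: "f t = p t - m t" "0 \<le> p t" "0 \<le> m t" for t by (auto simp: p_def m_def)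
  have pm: "integrable lborel p" "integrable lborel m"
    using f unfolding p_def[abs_def] m_def[abs_def] by auto
  then have [measurable]: "p \<in> borel_measurable borel" "m \<in> borel_measurable borel" by auto
  have ind: "integrable lborel (\<lambda>t. indicator {x<..} t * p t)" "integrable lborel (\<lambda>t. indicator {x<..} t * m t)" for x
    using integrable_mult_indicator[of "{x<..}" lborel p] integrable_mult_indicator[of "{x<..}" lborel m] pm by auto
  have em: "emeasure (density lborel (\<lambda>t. ennreal (g t))) {x<..} = ennreal (\<integral>t. indicator {x<..} t * g t \<partial>lborel)"
    if "integrable lborel (\<lambda>t. indicator {x<..} t * g t)" "\<And>t. 0 \<le> g t" "g \<in> borel_measurable borel" for g :: "real \<Rightarrow> real" and x
  proof -
    have "emeasure (density lborel (\<lambda>t. ennreal (g t))) {x<..} = (\<integral>\<^sup>+t. ennreal (indicator {x<..} t * g t) \<partial>lborel)"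
      using that(3) by (subst emeasure_density) (auto intro!: nn_integral_cong simp: indicator_def)
    also have "\<dots> = ennreal (\<integral>t. indicator {x<..} t * g t \<partial>lborel)"
      using that by (intro nn_integral_eq_integral) auto
    finally show ?thesis .
  qed
  have "density lborel (\<lambda>t. ennreal (p t)) = density lborel (\<lambda>t. ennreal (m t))"
  proof (rule measure_eqI_lessThan)
    fix x :: real
    have "(\<integral>t. indicator {x<..} t * p t \<partial>lborel) - (\<integral>t. indicator {x<..} t * m t \<partial>lborel) = 0"
      using tail[of x] ind[of x] by (simp add: fpm(1) right_diff_distrib)
    then show "emeasure (density lborel (\<lambda>t. ennreal (p t))) {x<..} = emeasure (density lborel (\<lambda>t. ennreal (m t))) {x<..}"
      using em[OF ind(1)[of x]] em[OF ind(2)[of x]] fpm by simp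
    show "emeasure (density lborel (\<lambda>t. ennreal (p t))) {x<..} < \<infinity>"
      using em[OF ind(1)[of x]] fpm by simp
  qed auto
  then have "AE t in lborel. ennreal (p t) = ennreal (m t)"
    by (intro sigma_finite_measure.density_unique[OF sigma_finite_lborel]) auto
  then show ?thesis
  proof eventually_elim
    case (elim t)
    then have "f t = 0" using fpm(1)[of t] fpm(2,3)[of t] by simp
    then show ?case by (auto simp: f_def)
  qed
qed

lemma AE_unit_interval_exists:
  assumes "AE t in lborel. 0 \<le> t \<longrightarrow> t \<le> (1::real) \<longrightarrow> P t"
  shows "\<exists>t. P t"
proof (rule ccontr)
  assume "\<nexists>t. P t"
  with assms have "AE t in lborel. t \<notin> {0..1::real}" by auto
  then have "{0..1::real} \<in> null_sets lborel"
    by (subst (asm) AE_iff_null_sets[symmetric]) auto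
  then show False by (auto simp: null_sets_def)
qed

text \<open>
  The integrals of \<open>F\<close> over the segments starting in a ball have a finite integral over that ball,
  so they are finite for almost every starting point.
\<close>

lemma AE_integrable_on_segments:
  fixes F :: "real^'n::finite \<Rightarrow> real^'n"
  assumes [measurable]: "F \<in> borel_measurable borel" and a: "0 \<le> a"
    and fin: "(\<integral>\<^sup>+x. ennreal ((norm x powr (- a) * norm (F x))\<^sup>2) \<partial>lborel) < \<infinity>"
  shows "AE x in lborel. integrable lborel (\<lambda>t. indicator {0..1} t * (F (x + t *\<^sub>R e) \<bullet> e))"
proof (rule AE_of_AE_cball)
  fix k :: nat
  let ?N = "\<lambda>x. ennreal (norm (F x))"
  let ?R = "real k + 1 * norm e"
  let ?S = "\<lambda>x. \<integral>\<^sup>+t\<in>{0..1}. ?N (x + t *\<^sub>R e) \<partial>lborel"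
  have R: "0 \<le> ?R" by simp
  have "(\<integral>\<^sup>+x\<in>cball 0 ?R. ?N x \<partial>lborel)\<^sup>2 < \<infinity>"
  proof (rule le_less_trans[OF nn_integral_ball_le_weighted[OF assms(1) a R]])
    show "ennreal (?R powr (2 * a)) * emeasure lborel (cball (0::real^'n) ?R) *
        (\<integral>\<^sup>+x. ennreal ((norm x powr (- a) * norm (F x))\<^sup>2) \<partial>lborel) < \<infinity>"
      using emeasure_lborel_cball_finite[of "0::real^'n" ?R] fin by (auto simp: ennreal_mult_less_top)
  qed
  then have "(\<integral>\<^sup>+x\<in>cball 0 ?R. ?N x \<partial>lborel) < \<infinity>"
    by (simp add: power2_eq_square ennreal_mult_less_top) auto
  then have "(\<integral>\<^sup>+x\<in>cball 0 (real k). ?S x \<partial>lborel) < \<infinity>"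
    by (intro le_less_trans[OF nn_integral_segments_le]) (auto simp: ennreal_mult_less_top)
  then have "AE x in lborel. ?S x * indicator (cball 0 (real k)) x \<noteq> \<infinity>"
    by (intro nn_integral_PInf_AE) auto
  then show "AE x in lborel. x \<in> cball 0 (real k) \<longrightarrow>
      integrable lborel (\<lambda>t. indicator {0..1} t * (F (x + t *\<^sub>R e) \<bullet> e))"
  proof eventually_elim
    case (elim x)
    show ?case
    proof
      assume "x \<in> cball 0 (real k)"
      then have "?S x < \<infinity>" using elim by (auto simp: less_top)
      have "(\<integral>\<^sup>+t. ennreal (norm (indicator {0..1} t * (F (x + t *\<^sub>R e) \<bullet> e))) \<partial>lborel)
          \<le> (\<integral>\<^sup>+t. ennreal (norm e) * (?N (x + t *\<^sub>R e) * indicator {0..1} t) \<partial>lborel)"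
        using Cauchy_Schwarz_ineq2[of _ e, unfolded mult.commute[of _ "norm e"]]
        by (intro nn_integral_mono) (auto simp: indicator_def ennreal_mult[symmetric])
      also have "\<dots> = ennreal (norm e) * ?S x" by (intro nn_integral_cmult) measurable
      also have "\<dots> < \<infinity>" using \<open>?S x < \<infinity>\<close> by (simp add: ennreal_mult_less_top)
      finally show "integrable lborel (\<lambda>t. indicator {0..1} t * (F (x + t *\<^sub>R e) \<bullet> e))"
        by (auto simp: integrable_iff_bounded)
    qed
  qed
qed

text \<open>
  In a fixed direction \<open>e\<close>, both gradients have the increments of \<open>u\<close> as their integrals, so along
  almost every line they agree at almost every point.  Exchanging the quantifiers gives a
  single translate on which they agree almost everywhere.
\<close>

lemma D_limit_unique:
  fixes u :: "real^'n::finite \<Rightarrow> real"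
  assumes D: "D_limit a u G" "D_limit a u H" and a: "0 \<le> a" "2 * a < real CARD('n)"
  shows "AE x in lborel. G x = H x"
proof -
  have [measurable]: "G \<in> borel_measurable borel" "H \<in> borel_measurable borel"
    using D by (auto simp: D_limit_def)
  have comp: "AE x in lborel. (G x - H x) \<bullet> e = 0" for e
  proof -
    let ?k = "\<lambda>x t. (G (x + t *\<^sub>R e) - H (x + t *\<^sub>R e)) \<bullet> e"
    let ?I = "\<lambda>F x h. \<integral>t. indicator {0..h::real} t * (F (x + t *\<^sub>R e) \<bullet> e) \<partial>lborel"
    have "AE x in lborel. ?I G x r = ?I H x r" if "0 \<le> r" for r
      using D_limit_increment[OF D(1) a(1) that, of e] D_limit_increment[OF D(2) a(1) that, of e]
      by eventually_elim simp
    then have "AE x in lborel. \<forall>r\<in>{r\<in>\<rat>. 0 \<le> r}. ?I G x r = ?I H x r"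
      by (subst AE_ball_countable) (auto intro: countable_subset[OF _ countable_rat])
    moreover have "AE x in lborel. integrable lborel (\<lambda>t. indicator {0..1} t * (G (x + t *\<^sub>R e) \<bullet> e))"
      "AE x in lborel. integrable lborel (\<lambda>t. indicator {0..1} t * (H (x + t *\<^sub>R e) \<bullet> e))"
      using D a by (auto intro!: AE_integrable_on_segments D_limit_weighted_gradient_finite)
    ultimately have slices: "AE x in lborel. AE t in lborel. 0 \<le> t \<longrightarrow> t \<le> 1 \<longrightarrow> ?k x t = 0"
    proof eventually_elim
      case (elim x)
      have eq: "indicator {0..1} t * ?k x t = indicator {0..1} t * (G (x + t *\<^sub>R e) \<bullet> e)
          - indicator {0..1} t * (H (x + t *\<^sub>R e) \<bullet> e)" for t :: real
        by (simp add: inner_diff_left right_diff_distrib)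
      show ?case
      proof (rule AE_zero_of_integrals_zero)
        show "integrable lborel (\<lambda>t. indicator {0..1} t * ?k x t)"
          unfolding eq using elim by (intro Bochner_Integration.integrable_diff) auto
        show "?k x \<in> borel_measurable borel" by measurable
        fix r :: real assume r: "r \<in> \<rat>" "0 \<le> r"
        \<comment> \<open>both gradients are known to be integrable on the unit segment only\<close>
        define s where "s = min r 1"
        have s: "s \<in> \<rat>" "0 \<le> s" "s \<le> 1" using r by (auto simp: s_def min_def)
        have int: "integrable lborel (\<lambda>t. indicator {0..s} t * (F (x + t *\<^sub>R e) \<bullet> e))"
          if "integrable lborel (\<lambda>t. indicator {0..1} t * (F (x + t *\<^sub>R e) \<bullet> e))" for F
        proof -
          have "indicator {0..s} t *\<^sub>R (indicator {0..1} t * (F (x + t *\<^sub>R e) \<bullet> e))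
              = indicator {0..s} t * (F (x + t *\<^sub>R e) \<bullet> e)" for t
            using s by (auto simp: indicator_def)
          moreover have "integrable lborel (\<lambda>t. indicator {0..s} t *\<^sub>R (indicator {0..1} t * (F (x + t *\<^sub>R e) \<bullet> e)))"
            by (intro integrable_mult_indicator that) simp
          ultimately show ?thesis by (simp only:)
        qed
        have "(\<integral>t. indicator {0..r} t * (indicator {0..1} t * ?k x t) \<partial>lborel)
            = (\<integral>t. indicator {0..s} t * (G (x + t *\<^sub>R e) \<bullet> e) - indicator {0..s} t * (H (x + t *\<^sub>R e) \<bullet> e) \<partial>lborel)"
          by (intro Bochner_Integration.integral_cong)
             (auto simp: indicator_def s_def inner_diff_left)
        also have "\<dots> = ?I G x s - ?I H x s"
          by (rule Bochner_Integration.integral_diff[OF int[OF elim(2)] int[OF elim(3)]])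
        also have "\<dots> = 0" using bspec[OF elim(1), of s] s by simp
        finally show "(\<integral>t. indicator {0..r} t * (indicator {0..1} t * ?k x t) \<partial>lborel) = 0" .
      qed
    qed
    have "{z \<in> space (lborel \<Otimes>\<^sub>M lborel). 0 \<le> snd z \<longrightarrow> snd z \<le> 1 \<longrightarrow> ?k (fst z) (snd z) = 0}
        \<in> sets ((lborel :: (real^'n) measure) \<Otimes>\<^sub>M (lborel :: real measure))"
      by measurable
    note lborel_pair.AE_commute[of "\<lambda>x t. 0 \<le> t \<longrightarrow> t \<le> 1 \<longrightarrow> ?k x t = 0", OF this, THEN iffD1, OF slices]
    then have "AE t in lborel. 0 \<le> t \<longrightarrow> t \<le> 1 \<longrightarrow> (AE x in lborel. ?k x t = 0)"
      by eventually_elim auto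
    from AE_unit_interval_exists[OF this] obtain t where "AE x in lborel. ?k x t = 0" ..
    from AE_translation[OF this, of "- t *\<^sub>R e"] show ?thesis by simp
  qed
  have "AE x in lborel. \<forall>i\<in>UNIV. (G x - H x) \<bullet> axis i 1 = 0"
    by (subst AE_finite_all) (auto intro: comp)
  then show ?thesis
    by eventually_elim (simp add: inner_axis vec_eq_iff)
qed

text \<open>
  All increments of \<open>u\<close> vanish almost everywhere, for each step \<open>e\<close>.  By Fubini there is one point
  \<open>x\<close> with \<open>u (x + e) = u x\<close> for almost every \<open>e\<close>.
\<close>

lemma D_limit_zero_gradient_imp_constant:
  fixes u :: "real^'n::finite \<Rightarrow> real"
  assumes D: "D_limit a u G" and a: "0 \<le> a" and G: "AE x in lborel. G x = 0"
  obtains c where "AE x in lborel. u x = c"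
proof -
  have [measurable]: "G \<in> borel_measurable borel" "u \<in> borel_measurable borel"
    using D by (auto simp: D_limit_def)
  have "AE x in lborel. u (x + e) = u x" for e
  proof -
    have "AE t in lborel. AE x in lborel. G (x + t *\<^sub>R e) = 0" for t :: real
      using AE_translation[OF G] by simp
    moreover have "{z \<in> space (lborel \<Otimes>\<^sub>M lborel). G (fst z + snd z *\<^sub>R e) = 0}
        \<in> sets ((lborel :: (real^'n) measure) \<Otimes>\<^sub>M (lborel :: real measure))"
      by measurable
    ultimately have "AE x in lborel. AE t in lborel. G (x + t *\<^sub>R e) = 0"
      using lborel_pair.AE_commute[of "\<lambda>x t. G (x + t *\<^sub>R e) = 0"] AE_translation[OF G] by simp
    then show ?thesis
      using D_limit_increment[OF D a, of 1 e, simplified]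
    proof eventually_elim
      case (elim x)
      have "(\<integral>t. indicator {0..1} t * (G (x + t *\<^sub>R e) \<bullet> e) \<partial>lborel) = 0"
        using elim(1) by (intro integral_eq_zero_AE) auto
      then show ?case using elim(2) by simp
    qed
  qed
  then have "AE e in lborel. AE x in lborel. u (x + e) = u x" by simp
  moreover have "{z \<in> space (lborel \<Otimes>\<^sub>M lborel). u (snd z + fst z) = u (snd z)}
        \<in> sets ((lborel :: (real^'n) measure) \<Otimes>\<^sub>M (lborel :: (real^'n) measure))"
    by measurable
  ultimately have *: "AE x in lborel. AE e in lborel. u (x + e) = u x"
    using lborel_pair.AE_commute[of "\<lambda>e x. u (x + e) = u x"] by simp
  have "\<exists>x. AE e in lborel. u (x + e) = u x"
  proof (rule ccontr)
    assume "\<not> ?thesis"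
    with * have "AE x in (lborel :: (real^'n) measure). False" by auto
    then have "emeasure lborel (UNIV :: (real^'n) set) = 0"
      by (simp add: AE_iff_measurable[OF _ refl])
    then show False by simp
  qed
  then obtain x where "AE e in lborel. u (x + e) = u x" by blast
  from AE_translation[OF this, of "- x"] show thesis by (intro that[of "u x"]) simp
qed

section \<open>Behaviour of the functionals under dilations\<close>

lemma D_limit_dilation:
  fixes u :: "real^'n::finite \<Rightarrow> real"
  assumes D: "D_limit a u G" and s: "0 < s"
  shows "D_limit a (\<lambda>x. k * u (s *\<^sub>R x)) (\<lambda>x. (k * s) *\<^sub>R G (s *\<^sub>R x))"
proof -
  have [measurable]: "u \<in> borel_measurable borel" "G \<in> borel_measurable borel"
    using D by (auto simp: D_limit_def)
  obtain \<phi> where \<phi>: "\<And>n. \<phi> n \<in> test_functions"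
    and \<phi>u: "\<And>K. compact K \<Longrightarrow> (\<lambda>n. \<integral>\<^sup>+x\<in>K. ennreal \<bar>\<phi> n x - u x\<bar> \<partial>lborel) \<longlonglongrightarrow> 0"
    and \<phi>G: "(\<lambda>n. \<integral>\<^sup>+x. ennreal ((norm x powr (- a) * norm (gradient (\<phi> n) x - G x))\<^sup>2) \<partial>lborel) \<longlonglongrightarrow> 0"
    using D by (auto simp: D_limit_def)
  have [measurable]: "\<phi> n \<in> borel_measurable borel" "gradient (\<phi> n) \<in> borel_measurable borel" for n
    using test_function_regular[OF \<phi>] by (auto intro: borel_measurable_continuous_onI)
  define \<psi> where "\<psi> n x = k * \<phi> n (s *\<^sub>R x)" for n x
  have grad: "gradient (\<psi> n) x = (k * s) *\<^sub>R gradient (\<phi> n) (s *\<^sub>R x)" for n x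
    unfolding \<psi>_def by (rule gradient_dilation) (rule test_function_regular(2)[OF \<phi>])
  have "(\<lambda>n. \<integral>\<^sup>+x\<in>K. ennreal \<bar>\<psi> n x - k * u (s *\<^sub>R x)\<bar> \<partial>lborel) \<longlonglongrightarrow> 0" if K: "compact K" for K
  proof -
    let ?K = "(*\<^sub>R) s ` K"
    have cK: "compact ?K" using K by (rule compact_scaling)
    then have [measurable]: "?K \<in> sets borel" by (intro borel_closed compact_imp_closed)
    have "ennreal \<bar>\<psi> n x - k * u (s *\<^sub>R x)\<bar> * indicator K x
        = ennreal \<bar>k\<bar> * (ennreal \<bar>\<phi> n (s *\<^sub>R x) - u (s *\<^sub>R x)\<bar> * indicator ?K (s *\<^sub>R x))" for n x
      using s by (auto simp: \<psi>_def indicator_def ennreal_mult[symmetric] right_diff_distrib[symmetric] abs_mult)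
    then have "(\<integral>\<^sup>+x\<in>K. ennreal \<bar>\<psi> n x - k * u (s *\<^sub>R x)\<bar> \<partial>lborel) = ennreal \<bar>k\<bar> *
        (\<integral>\<^sup>+x. ennreal \<bar>\<phi> n (s *\<^sub>R x) - u (s *\<^sub>R x)\<bar> * indicator ?K (s *\<^sub>R x) \<partial>lborel)" for n
      by (simp add: nn_integral_cmult)
    also have "\<dots> n = ennreal \<bar>k\<bar> * (ennreal (s powr (- real DIM(real^'n))) *
        (\<integral>\<^sup>+x\<in>?K. ennreal \<bar>\<phi> n x - u x\<bar> \<partial>lborel))" for n
      by (subst nn_integral_dilation[OF _ s, of "\<lambda>x. ennreal \<bar>\<phi> n x - u x\<bar> * indicator ?K x", symmetric]) auto
    finally have eq: "(\<integral>\<^sup>+x\<in>K. ennreal \<bar>\<psi> n x - k * u (s *\<^sub>R x)\<bar> \<partial>lborel) = ennreal \<bar>k\<bar> *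
        (ennreal (s powr (- real DIM(real^'n))) * (\<integral>\<^sup>+x\<in>?K. ennreal \<bar>\<phi> n x - u x\<bar> \<partial>lborel))" for n .
    have "(\<lambda>n. ennreal \<bar>k\<bar> * (ennreal (s powr (- real DIM(real^'n))) *
        (\<integral>\<^sup>+x\<in>?K. ennreal \<bar>\<phi> n x - u x\<bar> \<partial>lborel))) \<longlonglongrightarrow> ennreal \<bar>k\<bar> * (ennreal (s powr (- real DIM(real^'n))) * 0)"
      by (intro ennreal_tendsto_cmult \<phi>u cK) auto
    then show ?thesis unfolding eq by simp
  qed
  moreover have "(\<lambda>n. \<integral>\<^sup>+x. ennreal ((norm x powr (- a) *
      norm (gradient (\<psi> n) x - (k * s) *\<^sub>R G (s *\<^sub>R x)))\<^sup>2) \<partial>lborel) \<longlonglongrightarrow> 0"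
  proof -
    let ?c = "(s powr a * \<bar>k * s\<bar>)\<^sup>2"
    let ?f = "\<lambda>n x. ennreal ((norm x powr (- a) * norm (gradient (\<phi> n) x - G x))\<^sup>2)"
    have "ennreal ((norm x powr (- a) * norm (gradient (\<psi> n) x - (k * s) *\<^sub>R G (s *\<^sub>R x)))\<^sup>2)
        = ennreal ?c * ?f n (s *\<^sub>R x)" for n x
    proof -
      have "norm x powr (- a) = s powr a * norm (s *\<^sub>R x) powr (- a)"
        using s by (simp add: powr_mult powr_minus)
      moreover have "norm (gradient (\<psi> n) x - (k * s) *\<^sub>R G (s *\<^sub>R x))
          = \<bar>k * s\<bar> * norm (gradient (\<phi> n) (s *\<^sub>R x) - G (s *\<^sub>R x))"
        unfolding grad scaleR_right_diff_distrib[symmetric] norm_scaleR ..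
      ultimately have "(norm x powr (- a) * norm (gradient (\<psi> n) x - (k * s) *\<^sub>R G (s *\<^sub>R x)))\<^sup>2
          = ?c * (norm (s *\<^sub>R x) powr (- a) * norm (gradient (\<phi> n) (s *\<^sub>R x) - G (s *\<^sub>R x)))\<^sup>2"
        by (simp only: power_mult_distrib mult_ac)
      then show ?thesis by (simp only: ennreal_mult[OF zero_le_power2 zero_le_power2])
    qed
    then have "(\<integral>\<^sup>+x. ennreal ((norm x powr (- a) * norm (gradient (\<psi> n) x - (k * s) *\<^sub>R G (s *\<^sub>R x)))\<^sup>2) \<partial>lborel)
        = ennreal ?c * (\<integral>\<^sup>+x. ?f n (s *\<^sub>R x) \<partial>lborel)" for n
      by (simp only: nn_integral_cmult) (rule nn_integral_cmult, measurable)
    also have "\<dots> n = ennreal ?c * (ennreal (s powr (- real DIM(real^'n))) * (\<integral>\<^sup>+x. ?f n x \<partial>lborel))" for n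
      by (subst nn_integral_dilation[OF _ s, of "?f n", symmetric]) auto
    finally have eq: "(\<integral>\<^sup>+x. ennreal ((norm x powr (- a) * norm (gradient (\<psi> n) x - (k * s) *\<^sub>R G (s *\<^sub>R x)))\<^sup>2) \<partial>lborel)
        = ennreal ?c * (ennreal (s powr (- real DIM(real^'n))) * (\<integral>\<^sup>+x. ?f n x \<partial>lborel))" for n .
    have "(\<lambda>n. ennreal ?c * (ennreal (s powr (- real DIM(real^'n))) * (\<integral>\<^sup>+x. ?f n x \<partial>lborel)))
        \<longlonglongrightarrow> ennreal ?c * (ennreal (s powr (- real DIM(real^'n))) * 0)"
      by (intro ennreal_tendsto_cmult \<phi>G) auto
    then show ?thesis unfolding eq by simp
  qed
  moreover have "\<psi> n \<in> test_functions" for n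
    unfolding \<psi>_def using \<phi> s by (rule test_functions_dilation)
  ultimately show ?thesis unfolding D_limit_def by (intro conjI exI[of _ \<psi>]) auto
qed

lemma L_norm_powr:
  assumes "0 < r"
  shows "L_norm r f powr r = (\<integral>x. \<bar>f x\<bar> powr r \<partial>lborel)"
  using assms by (simp add: L_norm_def powr_powr)

lemma L_norm_2_squared: "(L_norm 2 f)\<^sup>2 = (\<integral>x. (f x)\<^sup>2 \<partial>lborel)"
proof -
  have "(L_norm 2 f)\<^sup>2 = L_norm 2 f powr 2" by (simp add: L_norm_def)
  then show ?thesis by (simp add: L_norm_powr)
qed

lemma D_limit_D_grad: "u \<in> D_space a \<Longrightarrow> D_limit a u (D_grad a u)"
  unfolding D_space_def D_grad_def mem_Collect_eq by (rule someI_ex[of "D_limit a u"])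

lemma D_space_measurable: "u \<in> D_space a \<Longrightarrow> u \<in> borel_measurable borel"
  by (auto simp: D_space_def D_limit_def)

lemma weighted_norm_dilation:
  fixes u :: "real^'n::finite \<Rightarrow> real"
  assumes [measurable]: "u \<in> borel_measurable borel" and s: "0 < s" and k: "0 \<le> k" and r: "0 < r"
  shows "weighted_norm c r (\<lambda>x. k * u (s *\<^sub>R x)) powr r
    = k powr r * s powr (c * r - real CARD('n)) * weighted_norm c r u powr r"
proof -
  let ?f = "\<lambda>x. \<bar>norm x powr (- c) * u x\<bar> powr r"
  have "\<bar>norm x powr (- c) * (k * u (s *\<^sub>R x))\<bar> powr r = k powr r * s powr (c * r) * ?f (s *\<^sub>R x)" for x
  proof -
    have eq: "norm x powr (- c) = s powr c * norm (s *\<^sub>R x) powr (- c)"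
      using s by (simp add: powr_mult powr_minus)
    have "\<bar>norm x powr (- c) * (k * u (s *\<^sub>R x))\<bar> = k * s powr c * \<bar>norm (s *\<^sub>R x) powr (- c) * u (s *\<^sub>R x)\<bar>"
      unfolding eq using k by (simp add: abs_mult)
    then show ?thesis using k by (simp add: powr_mult powr_powr)
  qed
  then have "weighted_norm c r (\<lambda>x. k * u (s *\<^sub>R x)) powr r
      = k powr r * s powr (c * r) * (\<integral>x. ?f (s *\<^sub>R x) \<partial>lborel)"
    by (simp only: weighted_norm_def L_norm_powr[OF r] integral_mult_right_zero)
  also have "\<dots> = k powr r * s powr (c * r) * (s powr (- real DIM(real^'n)) * (\<integral>x. ?f x \<partial>lborel))"
    by (subst integral_dilation[OF _ s, of ?f]) auto
  also have "(\<integral>x. ?f x \<partial>lborel) = weighted_norm c r u powr r"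
    by (simp only: weighted_norm_def L_norm_powr[OF r])
  finally show ?thesis
    by (simp add: powr_diff powr_minus field_simps)
qed

lemma B_int_dilation:
  fixes u v :: "real^'n::finite \<Rightarrow> real"
  assumes [measurable]: "u \<in> borel_measurable borel" "v \<in> borel_measurable borel" and s: "0 < s" and k: "0 \<le> k"
  shows "B_int b p q (\<lambda>x. k * u (s *\<^sub>R x)) (\<lambda>x. k * v (s *\<^sub>R x))
    = k powr (p + q) * s powr (b * (p + q) - real CARD('n)) * B_int b p q u v"
proof -
  let ?f = "\<lambda>x. \<bar>u x\<bar> powr p * \<bar>v x\<bar> powr q / norm x powr (b * (p + q))"
  have "\<bar>k * u (s *\<^sub>R x)\<bar> powr p * \<bar>k * v (s *\<^sub>R x)\<bar> powr q / norm x powr (b * (p + q))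
      = k powr (p + q) * s powr (b * (p + q)) * ?f (s *\<^sub>R x)" for x
    using s k by (simp add: abs_mult powr_mult powr_add)
  then have "B_int b p q (\<lambda>x. k * u (s *\<^sub>R x)) (\<lambda>x. k * v (s *\<^sub>R x))
      = k powr (p + q) * s powr (b * (p + q)) * (\<integral>x. ?f (s *\<^sub>R x) \<partial>lborel)"
    by (simp only: B_int_def integral_mult_right_zero)
  also have "\<dots> = k powr (p + q) * s powr (b * (p + q)) * (s powr (- real DIM(real^'n)) * (\<integral>x. ?f x \<partial>lborel))"
    by (subst integral_dilation[OF _ s, of ?f]) auto
  finally show ?thesis
    by (simp add: B_int_def powr_diff powr_minus field_simps)
qed

lemma grad_norm_squared:
  "(grad_norm a u)\<^sup>2 = (\<integral>x. (norm x powr (- a) * norm (D_grad a u x))\<^sup>2 \<partial>lborel)"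
  by (simp add: grad_norm_def L_norm_2_squared)

text \<open>
  The representative \<open>D_grad\<close> is picked by a choice operator, so its behaviour under dilation is known
  only through the uniqueness of the gradient.
\<close>

lemma grad_norm_dilation:
  fixes u :: "real^'n::finite \<Rightarrow> real"
  assumes u: "u \<in> D_space a" and s: "0 < s" and a: "0 \<le> a" "2 * a < real CARD('n)"
  shows "(grad_norm a (\<lambda>x. k * u (s *\<^sub>R x)))\<^sup>2 = k\<^sup>2 * s powr (2 + 2 * a - real CARD('n)) * (grad_norm a u)\<^sup>2"
proof -
  let ?v = "\<lambda>x. k * u (s *\<^sub>R x)" and ?G = "D_grad a u"
  have G: "D_limit a u ?G" by (rule D_limit_D_grad[OF u])
  have D: "D_limit a ?v (\<lambda>x. (k * s) *\<^sub>R ?G (s *\<^sub>R x))" by (rule D_limit_dilation[OF G s])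
  then have "?v \<in> D_space a" unfolding D_space_def by blast
  then have H: "D_limit a ?v (D_grad a ?v)" by (rule D_limit_D_grad)
  have [measurable]: "?G \<in> borel_measurable borel" "D_grad a ?v \<in> borel_measurable borel"
    using G H by (auto simp: D_limit_def)
  let ?f = "\<lambda>x. (norm x powr (- a) * norm (?G x))\<^sup>2"
  have "(grad_norm a ?v)\<^sup>2 = (\<integral>x. (norm x powr (- a) * norm (D_grad a ?v x))\<^sup>2 \<partial>lborel)"
    by (rule grad_norm_squared)
  also have "\<dots> = (\<integral>x. (k * s * s powr a)\<^sup>2 * ?f (s *\<^sub>R x) \<partial>lborel)"
  proof (rule integral_cong_AE)
    show "AE x in lborel. (norm x powr (- a) * norm (D_grad a ?v x))\<^sup>2 = (k * s * s powr a)\<^sup>2 * ?f (s *\<^sub>R x)"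
      using D_limit_unique[OF H D a]
    proof eventually_elim
      case (elim x)
      have "norm x powr (- a) = s powr a * norm (s *\<^sub>R x) powr (- a)"
        using s by (simp add: powr_mult powr_minus)
      then show ?case unfolding elim by (simp only: norm_scaleR power_mult_distrib power2_abs mult_ac)
    qed
  qed auto
  also have "\<dots> = (k * s * s powr a)\<^sup>2 * (s powr (- real DIM(real^'n)) * (\<integral>x. ?f x \<partial>lborel))"
    by (subst integral_mult_right_zero, subst integral_dilation[OF _ s, of ?f]) auto
  also have "(\<integral>x. ?f x \<partial>lborel) = (grad_norm a u)\<^sup>2" by (rule grad_norm_squared[symmetric])
  also have "(k * s * s powr a)\<^sup>2 = k\<^sup>2 * s powr (2 + 2 * a)"
  proof -
    have "k * s * s powr a = k * s powr (1 + a)" using s by (simp add: powr_add)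
    moreover have "(s powr (1 + a))\<^sup>2 = s powr (2 + 2 * a)"
      by (simp add: power2_eq_square powr_add[symmetric])
    ultimately show ?thesis by (simp only: power_mult_distrib)
  qed
  finally show ?thesis
    by (simp add: powr_diff powr_minus field_simps)
qed

lemma X_space_dilation:
  fixes u :: "real^'n::finite \<Rightarrow> real"
  assumes u: "u \<in> X_space a" and s: "0 < s"
  shows "(\<lambda>x. k * u (s *\<^sub>R x)) \<in> X_space a"
proof -
  let ?v = "\<lambda>x. k * u (s *\<^sub>R x)"
  have "u \<in> D_space a" using u by (simp add: X_space_def)
  from D_limit_dilation[OF D_limit_D_grad[OF this] s] have "?v \<in> D_space a"
    unfolding D_space_def by blast
  moreover have "radial ?v"
  proof -
    obtain f where "AE x in lborel. u x = f (norm x)" using u by (auto simp: X_space_def radial_def)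
    from AE_dilation[OF this s] have "AE x in lborel. ?v x = k * f (s * norm x)"
      by eventually_elim (use s in simp)
    then show ?thesis unfolding radial_def by (intro exI[of _ "\<lambda>r. k * f (s * r)"])
  qed
  moreover have "integrable lborel (\<lambda>x. norm x powr (- 2 * a) * (?v x)\<^sup>2)"
  proof -
    let ?f = "\<lambda>x. norm x powr (- 2 * a) * (u x)\<^sup>2"
    have "integrable lborel ?f" using u by (simp add: X_space_def)
    from integrable_dilation[OF this s]
    have "integrable lborel (\<lambda>x. (k\<^sup>2 * s powr (2 * a)) * ?f (s *\<^sub>R x))"
      by (rule integrable_mult_right)
    moreover have "(k\<^sup>2 * s powr (2 * a)) * ?f (s *\<^sub>R x) = norm x powr (- 2 * a) * (?v x)\<^sup>2" for x
      using s by (simp add: powr_mult powr_minus power_mult_distrib)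
    ultimately show ?thesis by (simp only:)
  qed
  ultimately show ?thesis by (simp add: X_space_def)
qed

text \<open>
  The exponent \<open>(N - 2 a) / 2\<close> is the one for which the weighted mass does not depend on \<open>s\<close>; the
  factor \<open>c\<close> adjusts the mass.
\<close>

definition mass_dilate :: "real \<Rightarrow> real \<Rightarrow> real \<Rightarrow> (real^'n::finite \<Rightarrow> real) \<Rightarrow> real^'n \<Rightarrow> real" where
  "mass_dilate a c s u = (\<lambda>x. c * s powr ((real CARD('n) - 2 * a) / 2) * u (s *\<^sub>R x))"

lemma X_space_mass_dilate:
  "u \<in> X_space a \<Longrightarrow> 0 < s \<Longrightarrow> mass_dilate a c s u \<in> X_space a"
  unfolding mass_dilate_def by (rule X_space_dilation)

lemma grad_norm_mass_dilate:
  fixes u :: "real^'n::finite \<Rightarrow> real"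
  assumes "u \<in> D_space a" and s: "0 < s" and "0 \<le> a" "2 * a < real CARD('n)"
  shows "(grad_norm a (mass_dilate a c s u))\<^sup>2 = c\<^sup>2 * s\<^sup>2 * (grad_norm a u)\<^sup>2"
proof -
  let ?h = "(real CARD('n) - 2 * a) / 2"
  have "(c * s powr ?h)\<^sup>2 * s powr (2 + 2 * a - real CARD('n)) = c\<^sup>2 * (s powr (?h + ?h + (2 + 2 * a - real CARD('n))))"
    by (simp only: power_mult_distrib power2_eq_square powr_add mult_ac)
  also have "?h + ?h + (2 + 2 * a - real CARD('n)) = 2" by (simp add: field_simps)
  finally show ?thesis
    unfolding mass_dilate_def grad_norm_dilation[OF assms] using s by simp
qed

text \<open>
  The exponent of \<open>s\<close> is \<open>r \<delta>(r)\<close> with \<open>\<delta>\<close> as in \<open>delta\<close>: it is \<open>0\<close> for the mass (\<open>b = a\<close>,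
  \<open>r = 2\<close>) and \<open>r\<close> for the critical exponent.
\<close>

lemma weighted_norm_mass_dilate:
  fixes u :: "real^'n::finite \<Rightarrow> real"
  assumes "u \<in> borel_measurable borel" and s: "0 < s" and c: "0 \<le> c" and r: "0 < r"
  shows "weighted_norm b r (mass_dilate a c s u) powr r
    = c powr r * s powr ((real CARD('n) - 2 * a + 2 * b) * r / 2 - real CARD('n)) * weighted_norm b r u powr r"
proof -
  let ?h = "(real CARD('n) - 2 * a) / 2"
  have "(c * s powr ?h) powr r * s powr (b * r - real CARD('n)) = c powr r * s powr (?h * r + (b * r - real CARD('n)))"
    using s c by (simp add: powr_mult powr_powr powr_add)
  also have "?h * r + (b * r - real CARD('n)) = (real CARD('n) - 2 * a + 2 * b) * r / 2 - real CARD('n)"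
    by (simp add: field_simps)
  finally show ?thesis
    unfolding mass_dilate_def using s c by (subst weighted_norm_dilation[OF assms(1) s _ r]) auto
qed

lemma B_int_mass_dilate:
  fixes u v :: "real^'n::finite \<Rightarrow> real"
  assumes "u \<in> borel_measurable borel" "v \<in> borel_measurable borel" and s: "0 < s"
  shows "B_int b p q (mass_dilate a 1 s u) (mass_dilate a 1 s v)
    = s powr ((real CARD('n) - 2 * a + 2 * b) * (p + q) / 2 - real CARD('n)) * B_int b p q u v"
proof -
  let ?h = "(real CARD('n) - 2 * a) / 2"
  have "(1 * s powr ?h) powr (p + q) * s powr (b * (p + q) - real CARD('n))
      = s powr (?h * (p + q) + (b * (p + q) - real CARD('n)))"
    using s by (simp only: mult_1 powr_powr powr_add[symmetric])
  also have "?h * (p + q) + (b * (p + q) - real CARD('n)) = (real CARD('n) - 2 * a + 2 * b) * (p + q) / 2 - real CARD('n)"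
    by (simp add: field_simps)
  finally show ?thesis
    unfolding mass_dilate_def using s by (subst B_int_dilation[OF assms]) auto
qed

lemma mass_norm_mass_dilate:
  fixes u :: "real^'n::finite \<Rightarrow> real"
  assumes "u \<in> borel_measurable borel" and "0 < s" and "0 \<le> c"
  shows "(weighted_norm a 2 (mass_dilate a c s u))\<^sup>2 = c\<^sup>2 * (weighted_norm a 2 u)\<^sup>2"
proof -
  have "0 \<le> weighted_norm a 2 w" for w :: "real^'n \<Rightarrow> real"
    by (simp add: weighted_norm_def L_norm_def)
  then show ?thesis using weighted_norm_mass_dilate[OF assms, of 2 a a] assms by simp
qed

section \<open>Positivity of the gradient norm\<close>

text \<open>
  With zero gradient \<open>u\<close> would be a constant \<open>c\<close>.  Its mass \<open>m\<close>, the integral of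
  \<open>(norm x powr (- a) * c)\<^sup>2\<close>, satisfies \<open>2 powr (- 2 a) m = 2 powr (- N) m\<close> by dilation, so \<open>m = 0\<close>.
\<close>

lemma grad_norm_pos:
  fixes u :: "real^'n::finite \<Rightarrow> real"
  assumes u: "u \<in> X_space a" and mass: "weighted_norm a 2 u \<noteq> 0" and a: "0 \<le> a" "2 * a < real CARD('n)"
  shows "0 < (grad_norm a u)\<^sup>2"
proof (rule ccontr)
  assume "\<not> 0 < (grad_norm a u)\<^sup>2"
  then have "(grad_norm a u)\<^sup>2 = 0" by simp
  then have zero: "(\<integral>x. (norm x powr (- a) * norm (D_grad a u x))\<^sup>2 \<partial>lborel) = 0"
    by (simp add: grad_norm_squared)
  have D: "D_limit a u (D_grad a u)" using u by (intro D_limit_D_grad) (simp add: X_space_def)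
  then have [measurable]: "D_grad a u \<in> borel_measurable borel" "u \<in> borel_measurable borel"
    by (simp_all add: D_limit_def)
  have "integrable lborel (\<lambda>x. (norm x powr (- a) * norm (D_grad a u x))\<^sup>2)"
    using D_limit_weighted_gradient_finite[OF D a] by (simp add: integrable_iff_bounded)
  then have "AE x in lborel. (norm x powr (- a) * norm (D_grad a u x))\<^sup>2 = 0"
    using zero by (subst (asm) integral_nonneg_eq_0_iff_AE) auto
  then have "AE x in lborel. D_grad a u x = 0"
    using AE_lborel_singleton[of "0::real^'n"] by eventually_elim simp
  from D_limit_zero_gradient_imp_constant[OF D a(1) this]
  obtain c where c: "AE x in lborel. u x = c" .
  let ?f = "\<lambda>x::real^'n. (norm x powr (- a) * c)\<^sup>2"
  have "(\<integral>x. ?f (2 *\<^sub>R x) \<partial>lborel) = 2 powr (- real DIM(real^'n)) * (\<integral>x. ?f x \<partial>lborel)"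
    by (rule integral_dilation) auto
  moreover have "?f (2 *\<^sub>R x) = 2 powr (- 2 * a) * ?f x" for x
  proof -
    have "2 powr (- 2 * a) = (2 powr (- a))\<^sup>2" by (simp add: power2_eq_square powr_add[symmetric])
    then show ?thesis by (simp add: powr_mult power_mult_distrib)
  qed
  ultimately have "2 powr (- 2 * a) * (\<integral>x. ?f x \<partial>lborel) = 2 powr (- real CARD('n)) * (\<integral>x. ?f x \<partial>lborel)"
    by simp
  moreover have "(2::real) powr (- real CARD('n)) < 2 powr (- 2 * a)"
    by (intro powr_less_mono) (use a in auto)
  then have "(2::real) powr (- 2 * a) \<noteq> 2 powr (- real CARD('n))" by (rule less_imp_neq[symmetric])
  ultimately have "(\<integral>x. ?f x \<partial>lborel) = 0" by (simp only: mult_cancel_right) blast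
  moreover have "(weighted_norm a 2 u)\<^sup>2 = (\<integral>x. ?f x \<partial>lborel)"
    unfolding weighted_norm_def L_norm_2_squared using c by (intro integral_cong_AE) auto
  ultimately show False using mass by simp
qed

section \<open>Subcritical integrability and decay of the interaction\<close>

text \<open>
  A Bochner integral that does not exist has the value zero, so a nonzero value certifies
  integrability.
\<close>

lemma critical_integrable:
  assumes "weighted_norm b t u powr t \<noteq> 0" and "0 < t"
  shows "integrable lborel (\<lambda>x. \<bar>norm x powr (- b) * u x\<bar> powr t)"
  using assms not_integrable_integral_eq unfolding weighted_norm_def L_norm_powr[OF assms(2)] by blast

lemma powr_le_sum_of_endpoints:
  fixes y :: real
  assumes "0 \<le> y" "r \<le> r'" "r' \<le> r''"
  shows "y powr r' \<le> y powr r + y powr r''"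
proof (cases "y \<le> 1")
  case True
  then have "y powr r' \<le> y powr r" using assms by (cases "y = 0") (auto intro: powr_mono')
  then show ?thesis by (simp add: add_increasing2)
next
  case False
  then have "y powr r' \<le> y powr r''" using assms by (intro powr_mono) auto
  then show ?thesis by (simp add: add_increasing)
qed

text \<open>
  In the unit ball the subcritical power is controlled by \<open>1\<close> and the critical power.
  Outside it is controlled by the square and the critical power, and there the weight
  \<open>norm x powr (- 2 b)\<close> is at most \<open>norm x powr (- 2 a)\<close>, so that the mass bounds the square.
\<close>

lemma subcritical_integrable:
  fixes u :: "real^'n::finite \<Rightarrow> real"
  assumes u: "u \<in> X_space a" and crit: "integrable lborel (\<lambda>x. \<bar>norm x powr (- b) * u x\<bar> powr t)"
    and ab: "a \<le> b" and r: "2 \<le> r" "r \<le> t"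
  shows "integrable lborel (\<lambda>x. \<bar>norm x powr (- b) * u x\<bar> powr r)"
proof -
  have [measurable]: "u \<in> borel_measurable borel"
    using u D_space_measurable[of u a] by (simp add: X_space_def)
  have sub: "integrable lborel (\<lambda>x. norm x powr (- 2 * a) * (u x)\<^sup>2)" using u by (simp add: X_space_def)
  have one: "integrable lborel (indicator (cball (0::real^'n) 1) :: _ \<Rightarrow> real)"
    using emeasure_lborel_cball_finite[of "0::real^'n" 1] by (intro integrable_real_indicator) auto
  let ?y = "\<lambda>x. \<bar>norm x powr (- b) * u x\<bar>"
  let ?w = "\<lambda>x. indicator (cball 0 1) x + norm x powr (- 2 * a) * (u x)\<^sup>2 + ?y x powr t"
  show ?thesis
  proof (rule Bochner_Integration.integrable_bound[of lborel ?w])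
    show "integrable lborel ?w" by (intro Bochner_Integration.integrable_add one sub crit)
    show "AE x in lborel. norm (?y x powr r) \<le> norm (?w x)"
    proof (intro AE_I2)
      fix x :: "real^'n"
      have "?y x powr r \<le> ?w x"
      proof (cases "norm x \<le> 1")
        case True
        have "?y x powr r \<le> ?y x powr 0 + ?y x powr t" using r by (intro powr_le_sum_of_endpoints) auto
        also have "?y x powr 0 \<le> 1" by simp
        finally have "?y x powr r \<le> 1 + ?y x powr t" by simp
        moreover have "0 \<le> norm x powr (- 2 * a) * (u x)\<^sup>2" by simp
        moreover have "indicator (cball 0 1) x = (1::real)" using True by simp
        ultimately show ?thesis by linarith
      next
        case False
        have "?y x powr r \<le> ?y x powr 2 + ?y x powr t" using r by (intro powr_le_sum_of_endpoints) auto
        also have "?y x powr 2 = norm x powr (- 2 * b) * (u x)\<^sup>2"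
        proof -
          have "(norm x powr (- b))\<^sup>2 = norm x powr (- 2 * b)" by (simp add: power2_eq_square powr_add[symmetric])
          then show ?thesis by (simp add: power_mult_distrib)
        qed
        also have "norm x powr (- 2 * b) * (u x)\<^sup>2 \<le> norm x powr (- 2 * a) * (u x)\<^sup>2"
          using False ab by (intro mult_right_mono powr_mono) auto
        finally have "?y x powr r \<le> norm x powr (- 2 * a) * (u x)\<^sup>2 + ?y x powr t" by simp
        then show ?thesis using False by simp
      qed
      then show "norm (?y x powr r) \<le> norm (?w x)" by simp
    qed
  qed measurable
qed

lemma B_int_nonneg: "0 \<le> B_int b p q u v"
  unfolding B_int_def by (intro Bochner_Integration.integral_nonneg) auto

lemma B_int_commute: "B_int b p q u v = B_int b q p v u"
  unfolding B_int_def by (simp add: mult.commute add.commute)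

text \<open>
  Young's inequality with a free parameter \<open>\<kappa>\<close>, by distinguishing which of \<open>v\<close> and \<open>\<kappa> u\<close> is larger.
\<close>

lemma B_int_le:
  fixes u v :: "real^'n::finite \<Rightarrow> real"
  assumes u: "integrable lborel (\<lambda>x. \<bar>norm x powr (- b) * u x\<bar> powr (p + q))"
    and v: "integrable lborel (\<lambda>x. \<bar>norm x powr (- b) * v x\<bar> powr (p + q))"
    and pq: "0 < p" "0 < q" and \<kappa>: "0 < \<kappa>"
  shows "B_int b p q u v \<le> \<kappa> powr q * weighted_norm b (p + q) u powr (p + q)
    + \<kappa> powr (- p) * weighted_norm b (p + q) v powr (p + q)"
proof -
  let ?y = "\<lambda>x. \<bar>norm x powr (- b) * u x\<bar>" and ?z = "\<lambda>x. \<bar>norm x powr (- b) * v x\<bar>"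
  have le: "\<bar>u x\<bar> powr p * \<bar>v x\<bar> powr q / norm x powr (b * (p + q))
      \<le> \<kappa> powr q * ?y x powr (p + q) + \<kappa> powr (- p) * ?z x powr (p + q)" for x
  proof -
    have "\<bar>u x\<bar> powr p * \<bar>v x\<bar> powr q / norm x powr (b * (p + q)) = ?y x powr p * ?z x powr q"
      by (simp add: abs_mult powr_mult powr_divide powr_powr powr_minus distrib_left powr_add field_simps)
    also have "\<dots> \<le> \<kappa> powr q * ?y x powr (p + q) + \<kappa> powr (- p) * ?z x powr (p + q)"
    proof (cases "?z x \<le> \<kappa> * ?y x")
      case True
      have "?y x powr p * ?z x powr q \<le> ?y x powr p * (\<kappa> * ?y x) powr q"
        using True pq by (intro mult_left_mono powr_mono2) auto
      also have "\<dots> = \<kappa> powr q * ?y x powr (p + q)"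
        using \<kappa> by (simp add: powr_mult powr_add)
      finally show ?thesis by (simp add: add_increasing2)
    next
      case False
      then have "?y x \<le> ?z x / \<kappa>" using \<kappa> by (simp add: field_simps)
      then have "?y x powr p * ?z x powr q \<le> (?z x / \<kappa>) powr p * ?z x powr q"
        using pq by (intro mult_right_mono powr_mono2) auto
      also have "\<dots> = \<kappa> powr (- p) * ?z x powr (p + q)"
        using \<kappa> by (simp add: powr_divide powr_mult powr_add powr_minus field_simps)
      finally show ?thesis by (simp add: add_increasing)
    qed
    finally show ?thesis .
  qed
  have "B_int b p q u v \<le> (\<integral>x. \<kappa> powr q * ?y x powr (p + q) + \<kappa> powr (- p) * ?z x powr (p + q) \<partial>lborel)"
    unfolding B_int_def
    by (rule integral_mono'[OF _ le]) (auto intro!: Bochner_Integration.integrable_add integrable_mult_right u v)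
  also have "\<dots> = \<kappa> powr q * (\<integral>x. ?y x powr (p + q) \<partial>lborel) + \<kappa> powr (- p) * (\<integral>x. ?z x powr (p + q) \<partial>lborel)"
    by (subst Bochner_Integration.integral_add) (auto intro!: integrable_mult_right u v)
  also have "\<dots> = \<kappa> powr q * weighted_norm b (p + q) u powr (p + q)
      + \<kappa> powr (- p) * weighted_norm b (p + q) v powr (p + q)"
    using pq by (simp only: weighted_norm_def L_norm_powr add_pos_pos)
  finally show ?thesis .
qed

text \<open>
  Write \<open>\<sigma>\<close> for the exponent in the last assumption.  The subcritical integral of the dilated
  function is of order \<open>\<tau> powr \<sigma>\<close>.  Young's inequality with \<open>\<kappa> = \<tau> powr (\<sigma> / (2 p))\<close> makes both
  of its terms small: the first through \<open>\<kappa> powr q\<close>, the second because \<open>\<kappa> powr (- p)\<close> consumes only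
  half of the available power of \<open>\<tau>\<close>.
\<close>

lemma B_int_mass_dilate_tendsto_0:
  fixes u :: "real^'n::finite \<Rightarrow> real"
  assumes u: "u \<in> X_space a" and crit: "weighted_norm b t u powr t \<noteq> 0"
    and ab: "a \<le> b" and pq: "0 < p" "0 < q" and r: "2 \<le> p + q" "p + q \<le> t" and c: "0 < c"
    and \<sigma>: "0 < (real CARD('n) - 2 * a + 2 * b) * (p + q) / 2 - real CARD('n)"
  shows "((\<lambda>\<tau>. B_int b p q u (mass_dilate a c \<tau> u)) \<longlongrightarrow> 0) (at_right 0)"
proof -
  define \<sigma> where "\<sigma> = (real CARD('n) - 2 * a + 2 * b) * (p + q) / 2 - real CARD('n)"
  have \<sigma>: "0 < \<sigma>" using \<sigma> by (simp add: \<sigma>_def)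
  have um: "u \<in> borel_measurable borel" using u D_space_measurable[of u a] by (simp add: X_space_def)
  define U where "U = weighted_norm b (p + q) u powr (p + q)"
  define F where "F \<tau> = \<tau> powr (\<sigma> / (2 * p) * q) * U + c powr (p + q) * \<tau> powr (\<sigma> / 2) * U" for \<tau>
  have t: "0 < t" using r by linarith
  have iu: "integrable lborel (\<lambda>x. \<bar>norm x powr (- b) * u x\<bar> powr (p + q))"
    by (rule subcritical_integrable[OF u critical_integrable[OF crit t] ab r])
  have bound: "B_int b p q u (mass_dilate a c \<tau> u) \<le> F \<tau>" if \<tau>: "0 < \<tau>" for \<tau>
  proof -
    let ?w = "mass_dilate a c \<tau> u"
    have "weighted_norm b t ?w powr t \<noteq> 0"
      using crit \<tau> c weighted_norm_mass_dilate[OF um \<tau> less_imp_le[OF c] t, of b a] by simp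
    from subcritical_integrable[OF X_space_mass_dilate[OF u \<tau>] critical_integrable[OF this t] ab r]
    have iw: "integrable lborel (\<lambda>x. \<bar>norm x powr (- b) * ?w x\<bar> powr (p + q))" .
    have W: "weighted_norm b (p + q) ?w powr (p + q) = c powr (p + q) * \<tau> powr \<sigma> * U"
      unfolding U_def \<sigma>_def using \<tau> c pq by (intro weighted_norm_mass_dilate um) auto
    let ?\<kappa> = "\<tau> powr (\<sigma> / (2 * p))"
    have "B_int b p q u ?w \<le> ?\<kappa> powr q * U + ?\<kappa> powr (- p) * (c powr (p + q) * \<tau> powr \<sigma> * U)"
      using B_int_le[OF iu iw pq, of ?\<kappa>] \<tau> unfolding W U_def[symmetric] by simp
    also have "?\<kappa> powr q = \<tau> powr (\<sigma> / (2 * p) * q)" by (simp add: powr_powr)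
    also have "?\<kappa> powr (- p) * (c powr (p + q) * \<tau> powr \<sigma> * U) = c powr (p + q) * \<tau> powr (\<sigma> / 2) * U"
    proof -
      have "?\<kappa> powr (- p) * \<tau> powr \<sigma> = \<tau> powr (\<sigma> / (2 * p) * (- p) + \<sigma>)"
        by (simp only: powr_powr powr_add)
      also have "\<sigma> / (2 * p) * (- p) + \<sigma> = \<sigma> / 2" using pq by (simp add: field_simps)
      finally show ?thesis by (simp add: mult_ac)
    qed
    finally show ?thesis by (simp add: F_def)
  qed
  have pow: "((\<lambda>\<tau>::real. \<tau> powr e) \<longlongrightarrow> 0) (at_right 0)" if "0 < e" for e
    by (rule tendsto_zero_powrI[OF tendsto_ident_at tendsto_const])
       (use that in \<open>auto simp: eventually_at_filter\<close>)
  have "(F \<longlongrightarrow> 0 * U + c powr (p + q) * 0 * U) (at_right 0)"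
    unfolding F_def using \<sigma> pq by (intro tendsto_intros pow) auto
  then have "(F \<longlongrightarrow> 0) (at_right 0)" by simp
  then show ?thesis
    by (rule tendsto_sandwich[OF _ _ tendsto_const, rotated 2])
       (auto simp: B_int_nonneg intro!: always_eventually eventually_mono[OF eventually_at_right_less] bound)
qed

section \<open>Choosing the scales\<close>

text \<open>
  Along the dilations of a pair the Pohozaev functional has the form \<open>s\<^sup>2 A + \<gamma> s powr \<sigma> - s powr t C\<close>.
  Since \<open>t > 2\<close> it is nonnegative for small \<open>s\<close>, so a negative value at \<open>s0\<close> leaves a root below.
\<close>

lemma fibre_root_below:
  fixes A C \<sigma> t \<gamma> s0 :: real
  assumes A: "0 < A" and C: "0 < C" and \<gamma>: "0 \<le> \<gamma>" and t: "2 < t" and s0: "0 < s0"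
    and neg: "s0\<^sup>2 * A + \<gamma> * s0 powr \<sigma> - s0 powr t * C < 0"
  obtains s where "0 < s" "s < s0" "s\<^sup>2 * A + \<gamma> * s powr \<sigma> - s powr t * C = 0"
proof -
  define f where "f s = s\<^sup>2 * A + \<gamma> * s powr \<sigma> - s powr t * C" for s
  \<comment> \<open>at \<open>s = (A / C) powr (1 / (t - 2))\<close> the terms \<open>s\<^sup>2 A\<close> and \<open>s powr t C\<close> balance\<close>
  define e where "e = min (s0 / 2) ((A / C) powr (1 / (t - 2)))"
  have e: "0 < e" "e < s0" using s0 A C by (auto simp: e_def)
  have "e powr (t - 2) \<le> ((A / C) powr (1 / (t - 2))) powr (t - 2)"
    using e t by (intro powr_mono2) (auto simp: e_def)
  also have "\<dots> = A / C" using t A C by (simp add: powr_powr)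
  finally have "e powr (t - 2) * C \<le> A" using C by (simp add: field_simps)
  moreover have "e powr t = e\<^sup>2 * e powr (t - 2)"
    using e by (simp add: powr_diff)
  ultimately have "e powr t * C \<le> e\<^sup>2 * A" using e by (simp add: mult_left_mono mult.assoc)
  moreover have "0 \<le> \<gamma> * e powr \<sigma>" using \<gamma> by simp
  ultimately have "0 \<le> f e" unfolding f_def by linarith
  moreover have "f s0 \<le> 0" using neg by (simp add: f_def)
  moreover have "continuous_on {e..s0} f"
    unfolding f_def using e by (intro continuous_intros) auto
  ultimately obtain s where s: "e \<le> s" "s \<le> s0" "f s = 0"
    using IVT2'[of f s0 0 e] e by auto
  moreover have "s \<noteq> s0" using s neg by (auto simp: f_def)
  ultimately show thesis using that[of s] e by (auto simp: f_def)
qed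

text \<open>
  Here \<open>A + K \<tau>\<^sup>2\<close>, \<open>C + L \<tau> powr t\<close> and \<open>g \<tau>\<close> are the gradient, critical and interaction terms
  of the pair formed by \<open>u\<close> and its spread-out copy, and \<open>\<gamma>\<close> is \<open>- \<beta>\<close>.  At a root of the Pohozaev
  functional the critical term can be eliminated from the energy, and what results is increasing
  in \<open>s\<close>, so it suffices to bound the root.  Fix \<open>s0 > 1\<close> with
  \<open>s0\<^sup>2 A < A + B\<close>.  In the limit \<open>\<tau> \<rightarrow> 0\<close> the functional at \<open>s0\<close> is at most
  \<open>s0\<^sup>2 A - s0 powr t C\<close>, which is negative because \<open>A \<le> C\<close>; hence for small \<open>\<tau>\<close> there is a root
  below \<open>s0\<close>.
\<close>

lemma cheaper_competitor_scales:
  fixes A B C K L \<sigma> t \<gamma> :: real and g :: "real \<Rightarrow> real"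
  assumes A: "0 < A" "A \<le> C" and B: "0 < B" and KL: "0 \<le> K" "0 \<le> L" and \<gamma>: "0 \<le> \<gamma>"
    and t: "2 < t" and \<sigma>: "0 < \<sigma>" "\<sigma> < t"
    and g: "\<And>\<tau>. 0 \<le> g \<tau>" "(g \<longlongrightarrow> 0) (at_right 0)"
  obtains s \<tau> where "0 < s" "0 < \<tau>"
    "s\<^sup>2 * (A + K * \<tau>\<^sup>2) + \<gamma> * \<sigma> * (s powr \<sigma> * g \<tau>) - s powr t * (C + L * \<tau> powr t) = 0"
    "1 / 2 * (s\<^sup>2 * (A + K * \<tau>\<^sup>2)) + \<gamma> * (s powr \<sigma> * g \<tau>) - 1 / t * (s powr t * (C + L * \<tau> powr t))
      < (1 / 2 - 1 / t) * (A + B)"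
proof -
  define M where "M = 1 / 2 - 1 / t"
  have M: "0 < M" using t by (simp add: M_def field_simps)
  \<comment> \<open>chosen so that the gradient term at \<open>s0\<close> is half-way between \<open>A\<close> and \<open>A + B\<close>\<close>
  define s0 where "s0 = sqrt (1 + B / (2 * A))"
  have s0: "1 < s0" "s0\<^sup>2 * A = A + B / 2"
    using A B by (auto simp: s0_def field_simps)
  let ?P = "\<lambda>\<tau>. s0\<^sup>2 * (A + K * \<tau>\<^sup>2) + \<gamma> * \<sigma> * g \<tau> * s0 powr \<sigma> - s0 powr t * C"
  let ?E = "\<lambda>\<tau>. M * (s0\<^sup>2 * (A + K * \<tau>\<^sup>2)) + \<gamma> * (1 - \<sigma> / t) * g \<tau> * s0 powr \<sigma>"
  have "(?P \<longlongrightarrow> s0\<^sup>2 * (A + K * 0\<^sup>2) + \<gamma> * \<sigma> * 0 * s0 powr \<sigma> - s0 powr t * C) (at_right 0)"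
    by (intro tendsto_intros g)
  moreover have "s0\<^sup>2 * A < s0 powr t * C"
  proof -
    have "s0\<^sup>2 = s0 powr 2" using s0 by simp
    also have "\<dots> < s0 powr t" using s0 t by (intro powr_less_mono) auto
    finally have "s0\<^sup>2 * A < s0 powr t * A" by (rule mult_strict_right_mono[OF _ A(1)])
    also have "\<dots> \<le> s0 powr t * C" using A by (intro mult_left_mono) auto
    finally show ?thesis .
  qed
  ultimately have P: "\<forall>\<^sub>F \<tau> in at_right 0. ?P \<tau> < 0" by (intro order_tendstoD) auto
  have "(?E \<longlongrightarrow> M * (s0\<^sup>2 * (A + K * 0\<^sup>2)) + \<gamma> * (1 - \<sigma> / t) * 0 * s0 powr \<sigma>) (at_right 0)"
    by (intro tendsto_intros g)
  moreover have "M * (s0\<^sup>2 * A) < M * (A + B)" using s0 B M by simp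
  ultimately have E: "\<forall>\<^sub>F \<tau> in at_right 0. ?E \<tau> < M * (A + B)" by (intro order_tendstoD) auto
  obtain \<tau> where \<tau>: "0 < \<tau>" "?P \<tau> < 0" "?E \<tau> < M * (A + B)"
    using eventually_happens[OF eventually_conj[OF eventually_at_right_less eventually_conj[OF P E]]]
      trivial_limit_at_right_real by auto
  define A' where "A' = A + K * \<tau>\<^sup>2"
  define C' where "C' = C + L * \<tau> powr t"
  have A': "0 < A'" using A KL by (auto simp: A'_def intro: add_pos_nonneg)
  have C': "0 < C'" "C \<le> C'" using A KL by (auto simp: C'_def intro: add_pos_nonneg)
  have "s0 powr t * C \<le> s0 powr t * C'" using C' by (intro mult_left_mono) auto
  then have "s0\<^sup>2 * A' + \<gamma> * \<sigma> * g \<tau> * s0 powr \<sigma> - s0 powr t * C' < 0"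
    using \<tau>(2) by (simp add: A'_def)
  moreover have "0 \<le> \<gamma> * \<sigma> * g \<tau>" using \<gamma> \<sigma> g by simp
  ultimately obtain s where s: "0 < s" "s < s0" "s\<^sup>2 * A' + \<gamma> * \<sigma> * g \<tau> * s powr \<sigma> - s powr t * C' = 0"
    using fibre_root_below[of A' C' "\<gamma> * \<sigma> * g \<tau>" t s0 \<sigma>] A' C' t s0 by auto
  have "1 / 2 * (s\<^sup>2 * A') + \<gamma> * (s powr \<sigma> * g \<tau>) - 1 / t * (s powr t * C')
      = M * (s\<^sup>2 * A') + \<gamma> * (1 - \<sigma> / t) * g \<tau> * s powr \<sigma>"
  proof -
    have "s powr t * C' = s\<^sup>2 * A' + \<gamma> * \<sigma> * g \<tau> * s powr \<sigma>" using s(3) by simp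
    then show ?thesis using t by (simp add: M_def field_simps)
  qed
  also have "\<dots> \<le> ?E \<tau>"
  proof (intro add_mono mult_left_mono)
    show "s\<^sup>2 * A' \<le> s0\<^sup>2 * (A + K * \<tau>\<^sup>2)"
      unfolding A'_def[symmetric] using s A' by (intro mult_right_mono power_mono) auto
    show "s powr \<sigma> \<le> s0 powr \<sigma>" using s \<sigma> by (intro powr_mono2) auto
  qed (use M \<gamma> \<sigma> t g in auto)
  finally have "1 / 2 * (s\<^sup>2 * A') + \<gamma> * (s powr \<sigma> * g \<tau>) - 1 / t * (s powr t * C') < M * (A + B)"
    using \<tau>(3) by simp
  then show thesis
    using s \<tau>(1) by (intro that[of s \<tau>]) (auto simp: A'_def C'_def M_def mult_ac)
qed

section \<open>The competitor\<close>

text \<open>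
  The pair is \<open>(u\<^sub>s, c u\<^bsub>s\<tau>\<^esub>)\<close>.  Dilating both components by the same \<open>s\<close> makes the interaction
  an exact power of \<open>s\<close>, so that for fixed \<open>\<tau>\<close> the constraint is an equation between powers of \<open>s\<close>.
\<close>

lemma lower_energy_competitor:
  fixes u v :: "real^'n::finite \<Rightarrow> real" and a b p q \<rho>1 \<rho>2 \<beta> :: real
  assumes a: "0 \<le> a" "a < (real CARD('n) - 2) / 2" and b: "a < b" "b < a + 1"
    and pq: "0 < p" "0 < q" "2 < p + q" "p + q < two_sharp TYPE('n) a b"
    and \<rho>: "0 < \<rho>1" "0 < \<rho>2" and \<beta>: "\<beta> \<le> 0"
    and uv: "(u, v) \<in> N_set a b p q \<beta> \<rho>1 \<rho>2"
    and le: "(grad_norm a u)\<^sup>2 \<le> weighted_norm b (two_sharp TYPE('n) a b) u powr two_sharp TYPE('n) a b"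
  shows "\<exists>(u' :: real^'n \<Rightarrow> real) v'. (u', v') \<in> N_set a b p q \<beta> \<rho>1 \<rho>2 \<and> energy a b p q \<beta> u' v' < energy a b p q \<beta> u v"
proof -
  define N where "N = real CARD('n)"
  define t where "t = two_sharp TYPE('n) a b"
  define D where "D = N - 2 * (1 + a - b)"
  define \<sigma> where "\<sigma> = (N - 2 * a + 2 * b) * (p + q) / 2 - N"
  have D: "0 < D" "D < N" using a b by (auto simp: D_def N_def field_simps)
  have "0 < N" by (simp add: N_def)
  have tD: "t * D = 2 * N" using D by (simp add: t_def two_sharp_def D_def N_def)
  have t2: "2 < t"
  proof -
    have "2 * D < t * D" using D tD by simp
    then show ?thesis using D by simp
  qed
  \<comment> \<open>the critical exponent is the fixed point of \<open>r \<mapsto> r \<delta>(r)\<close>\<close>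
  have t_exp: "(N - 2 * a + 2 * b) * t / 2 - N = t" using tD by (simp add: D_def field_simps)
  have coeff: "0 < N - 2 * a + 2 * b" using a b \<open>0 < N\<close> by (simp add: N_def field_simps)
  have \<sigma>: "0 < \<sigma>" "\<sigma> < t"
  proof -
    have "(N - 2 * a + 2 * b) * 2 < (N - 2 * a + 2 * b) * (p + q)"
      using coeff pq by (intro mult_strict_left_mono) auto
    then show "0 < \<sigma>" using b by (simp add: \<sigma>_def)
    have "(N - 2 * a + 2 * b) * (p + q) < (N - 2 * a + 2 * b) * t"
      using coeff pq by (intro mult_strict_left_mono) (auto simp: t_def)
    then show "\<sigma> < t" using t_exp by (simp add: \<sigma>_def)
  qed
  have \<sigma>_delta: "(p + q) * delta TYPE('n) a b (p + q) = \<sigma>"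
    using pq by (simp add: delta_def \<sigma>_def N_def field_simps)
  have a2: "2 * a < real CARD('n)" using a by simp
  have u: "u \<in> X_space a" "u \<in> D_space a" and v: "v \<in> X_space a"
    and mass: "(weighted_norm a 2 u)\<^sup>2 = \<rho>1\<^sup>2" "(weighted_norm a 2 v)\<^sup>2 = \<rho>2\<^sup>2"
    and P: "pohozaev a b p q \<beta> u v = 0"
    using uv by (auto simp: N_set_def S_set_def X_space_def)
  have um: "u \<in> borel_measurable borel" by (rule D_space_measurable[OF u(2)])
  define A where "A = (grad_norm a u)\<^sup>2"
  define B where "B = (grad_norm a v)\<^sup>2"
  define C where "C = weighted_norm b t u powr t"
  define c where "c = \<rho>2 / \<rho>1"
  have c: "0 < c" "c\<^sup>2 * \<rho>1\<^sup>2 = \<rho>2\<^sup>2" using \<rho> by (auto simp: c_def power_divide)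
  have "weighted_norm a 2 u \<noteq> 0" "weighted_norm a 2 v \<noteq> 0" using mass \<rho> by auto
  then have A: "0 < A" and B: "0 < B"
    unfolding A_def B_def using grad_norm_pos[OF _ _ a(1) a2] u v by auto
  have AC: "A \<le> C" using le by (simp add: A_def C_def t_def)
  define w where "w \<tau> = mass_dilate a c \<tau> u" for \<tau>
  define g where "g \<tau> = B_int b p q u (w \<tau>)" for \<tau>
  have "(g \<longlongrightarrow> 0) (at_right 0)"
    unfolding g_def w_def
  proof (rule B_int_mass_dilate_tendsto_0[where t = t])
    show "weighted_norm b t u powr t \<noteq> 0" using A AC unfolding C_def by linarith
  qed (use u b pq c \<sigma> in \<open>auto simp: t_def \<sigma>_def N_def\<close>)
  then obtain s \<tau> where s: "0 < s" "0 < \<tau>"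
    and root: "s\<^sup>2 * (A + c\<^sup>2 * A * \<tau>\<^sup>2) + (- \<beta>) * \<sigma> * (s powr \<sigma> * g \<tau>) - s powr t * (C + c powr t * C * \<tau> powr t) = 0"
    and low: "1 / 2 * (s\<^sup>2 * (A + c\<^sup>2 * A * \<tau>\<^sup>2)) + (- \<beta>) * (s powr \<sigma> * g \<tau>)
        - 1 / t * (s powr t * (C + c powr t * C * \<tau> powr t)) < (1 / 2 - 1 / t) * (A + B)"
    using cheaper_competitor_scales[of A C B "c\<^sup>2 * A" "c powr t * C" "- \<beta>" t \<sigma> g] A AC B \<beta> t2 \<sigma>
    by (auto simp: g_def B_int_nonneg)
  define u' where "u' = mass_dilate a 1 s u"
  define v' where "v' = mass_dilate a 1 s (w \<tau>)"
  have w: "w \<tau> \<in> X_space a" unfolding w_def using u s by (intro X_space_mass_dilate) auto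
  then have w': "w \<tau> \<in> D_space a" by (simp add: X_space_def)
  then have wm: "w \<tau> \<in> borel_measurable borel" by (rule D_space_measurable)
  have t0: "0 < t" using t2 by simp
  have grad: "(grad_norm a u')\<^sup>2 = s\<^sup>2 * A" "(grad_norm a v')\<^sup>2 = s\<^sup>2 * (c\<^sup>2 * A * \<tau>\<^sup>2)"
    using grad_norm_mass_dilate[OF u(2) s(1) a(1) a2, of 1] grad_norm_mass_dilate[OF w' s(1) a(1) a2, of 1]
      grad_norm_mass_dilate[OF u(2) s(2) a(1) a2, of c]
    by (simp_all add: u'_def v'_def w_def[symmetric] A_def)
  have crit: "weighted_norm b t u' powr t = s powr t * C"
    "weighted_norm b t v' powr t = s powr t * (c powr t * C * \<tau> powr t)"
    using weighted_norm_mass_dilate[OF um s(1) zero_le_one t0, of b a]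
      weighted_norm_mass_dilate[OF wm s(1) zero_le_one t0, of b a]
      weighted_norm_mass_dilate[OF um s(2) less_imp_le[OF c(1)] t0, of b a]
    unfolding N_def[symmetric] t_exp
    by (simp_all add: u'_def v'_def w_def[symmetric] C_def)
  have B': "B_int b p q u' v' = s powr \<sigma> * g \<tau>"
    using B_int_mass_dilate[OF um wm s(1), of b p q a]
    by (simp add: u'_def v'_def g_def \<sigma>_def N_def)
  have "(weighted_norm a 2 u')\<^sup>2 = \<rho>1\<^sup>2" "(weighted_norm a 2 v')\<^sup>2 = \<rho>2\<^sup>2"
    using mass_norm_mass_dilate[OF um s(1), of 1 a] mass_norm_mass_dilate[OF wm s(1), of 1 a]
      mass_norm_mass_dilate[OF um s(2) less_imp_le[OF c(1)], of a] mass c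
    by (simp_all add: u'_def v'_def w_def[symmetric])
  moreover have "u' \<in> X_space a" "v' \<in> X_space a"
    unfolding u'_def v'_def using u w s by (auto intro: X_space_mass_dilate)
  moreover have "pohozaev a b p q \<beta> u' v' = 0"
    using root unfolding pohozaev_def Let_def t_def[symmetric] grad crit B'
    by (simp only: mult.assoc \<sigma>_delta) (simp add: algebra_simps \<sigma>_delta[symmetric])
  ultimately have "(u', v') \<in> N_set a b p q \<beta> \<rho>1 \<rho>2"
    by (simp add: N_set_def S_set_def)
  moreover have "energy a b p q \<beta> u' v' < energy a b p q \<beta> u v"
  proof (rule less_le_trans)
    show "energy a b p q \<beta> u' v' < (1 / 2 - 1 / t) * (A + B)"
      using low unfolding energy_def Let_def t_def[symmetric] grad crit B' by (simp add: algebra_simps)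
    let ?I = "B_int b p q u v" and ?V = "weighted_norm b t v powr t"
    have "A + B - \<beta> * \<sigma> * ?I - (C + ?V) = 0"
      using P unfolding pohozaev_def Let_def t_def[symmetric] A_def[symmetric] B_def[symmetric] C_def[symmetric]
        \<sigma>_delta[symmetric] by (simp add: mult.assoc)
    then have CV: "C + ?V = A + B - \<beta> * \<sigma> * ?I" by simp
    have "energy a b p q \<beta> u v = (1 / 2 - 1 / t) * (A + B) + (- \<beta>) * (1 - \<sigma> / t) * ?I"
      unfolding energy_def Let_def t_def[symmetric] A_def[symmetric] B_def[symmetric] C_def[symmetric] CV
      using t0 by (simp add: field_simps)
    moreover have "0 \<le> (- \<beta>) * (1 - \<sigma> / t) * ?I"
      using \<beta> \<sigma> t0 by (intro mult_nonneg_nonneg B_int_nonneg) auto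
    ultimately show "(1 / 2 - 1 / t) * (A + B) \<le> energy a b p q \<beta> u v" by simp
  qed
  ultimately show ?thesis by blast
qed

lemma N_set_commute: "(u, v) \<in> N_set a b p q \<beta> \<rho>1 \<rho>2 \<longleftrightarrow> (v, u) \<in> N_set a b q p \<beta> \<rho>2 \<rho>1"
  by (auto simp: N_set_def S_set_def pohozaev_def Let_def B_int_commute[of b p q] add.commute)

lemma energy_commute: "energy a b p q \<beta> u v = energy a b q p \<beta> v u"
  by (simp add: energy_def Let_def B_int_commute[of b p q] add.commute)

theorem theorem2p4:
  fixes a b p q \<rho>1 \<rho>2 \<beta> :: real
  assumes "CARD('n::finite) \<ge> 3"
    and "max 0 ((real CARD('n) - 4) / 2) \<le> a" and "a < (real CARD('n) - 2) / 2"
    and "a < b" and "b < a + 1"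
    and "p > 1" and "q > 1" and "2 < p + q" and "p + q < two_sharp TYPE('n) a b"
    and "\<rho>1 > 0" and "\<rho>2 > 0"
    and "\<beta> \<le> 0"
  shows "\<not> (\<exists>(u :: real^'n \<Rightarrow> real, v :: real^'n \<Rightarrow> real) \<in> N_set a b p q \<beta> \<rho>1 \<rho>2.
            ereal (energy a b p q \<beta> u v) = m_level TYPE('n) a b p q \<beta> \<rho>1 \<rho>2)"
proof
  assume "\<exists>(u :: real^'n \<Rightarrow> real, v :: real^'n \<Rightarrow> real) \<in> N_set a b p q \<beta> \<rho>1 \<rho>2.
            ereal (energy a b p q \<beta> u v) = m_level TYPE('n) a b p q \<beta> \<rho>1 \<rho>2"
  then obtain u v :: "real^'n \<Rightarrow> real" where uv: "(u, v) \<in> N_set a b p q \<beta> \<rho>1 \<rho>2"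
    and min: "ereal (energy a b p q \<beta> u v) = m_level TYPE('n) a b p q \<beta> \<rho>1 \<rho>2" by blast
  let ?t = "two_sharp TYPE('n) a b"
  have a: "0 \<le> a" using assms(2) by simp
  have "pohozaev a b p q \<beta> u v = 0" using uv by (simp add: N_set_def)
  moreover have "\<beta> * (p + q) * delta TYPE('n) a b (p + q) * B_int b p q u v \<le> 0"
  proof -
    have "0 \<le> (p + q) * delta TYPE('n) a b (p + q)"
    proof -
      have "real CARD('n) * 2 \<le> (real CARD('n) - 2 * a + 2 * b) * (p + q)"
        using assms by (intro mult_mono) auto
      then show ?thesis using assms by (simp add: delta_def)
    qed
    then have "0 \<le> (p + q) * delta TYPE('n) a b (p + q) * B_int b p q u v"
      by (rule mult_nonneg_nonneg[OF _ B_int_nonneg])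
    with assms(12) have "\<beta> * ((p + q) * delta TYPE('n) a b (p + q) * B_int b p q u v) \<le> 0"
      by (rule mult_nonpos_nonneg)
    then show ?thesis by (simp only: mult.assoc)
  qed
  ultimately consider "(grad_norm a u)\<^sup>2 \<le> weighted_norm b ?t u powr ?t"
    | "(grad_norm a v)\<^sup>2 \<le> weighted_norm b ?t v powr ?t"
    unfolding pohozaev_def Let_def by linarith
  then have "\<exists>(u' :: real^'n \<Rightarrow> real) v'. (u', v') \<in> N_set a b p q \<beta> \<rho>1 \<rho>2 \<and> energy a b p q \<beta> u' v' < energy a b p q \<beta> u v"
  proof cases
    case 1
    show ?thesis by (rule lower_energy_competitor[OF a _ _ _ _ _ _ _ _ _ _ uv 1]) (use assms in auto)
  next
    case 2
    have vu: "(v, u) \<in> N_set a b q p \<beta> \<rho>2 \<rho>1" using uv N_set_commute by blast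
    have "\<exists>(v' :: real^'n \<Rightarrow> real) u'. (v', u') \<in> N_set a b q p \<beta> \<rho>2 \<rho>1 \<and> energy a b q p \<beta> v' u' < energy a b q p \<beta> v u"
      by (rule lower_energy_competitor[OF a _ _ _ _ _ _ _ _ _ _ vu 2]) (use assms in auto)
    then show ?thesis using N_set_commute energy_commute by metis
  qed
  then obtain u' v' :: "real^'n \<Rightarrow> real" where "(u', v') \<in> N_set a b p q \<beta> \<rho>1 \<rho>2" "energy a b p q \<beta> u' v' < energy a b p q \<beta> u v"
    by blast
  moreover from this(1) have "m_level TYPE('n) a b p q \<beta> \<rho>1 \<rho>2 \<le> ereal (energy a b p q \<beta> u' v')"
    unfolding m_level_def
    using INF_lower[of "(u', v')" _ "\<lambda>(u, v). ereal (energy a b p q \<beta> u v)"] by simp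
  ultimately show False using min by (metis ereal_less_eq(3) not_le)
qed

end
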